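(* Consider the problem $\min_{x\in\mathbb{R}^N} g(x)+F(x)$, $F=\frac1n\sum_{i=1}^n f_i$, under the Problem Properties assumption, and let $(x^k,y_1^k,\dots,y_n^k)_{k\ge 0}$ be the iterates of the PVRSG algorithm with step-size $\lambda>0$, sampling probabilities $p_i$ and satisfying the Coherent Dual Update assumption, with common expected update frequency $\eta$ (all given in the context). Let $x^\star$ be the unique solution and $y_i^\star=\nabla f_i(x^\star)$. (i) Suppose $\max_i\frac{L_i}{np_i}>\mu$. If there exists $\rho\in(0,\eta)$ such that $$\rho=\mu\lambda(2-\nu\lambda),\qquad \nu=\mu+\Big(\max_i\frac{L_i}{np_i}-\mu\Big)\Big(1+\sqrt{\frac{\eta}{\eta-\rho}}\Big)^2,$$ then $$\mathbb{E}\Big[\|x^k-x^\star\|^2+\sum_{i=1}^n\widehat\gamma_i\|y_i^k-y_i^\star\|^2\Big]\in\mathcal{O}\big((1-\rho)^k\big),$$ where $\widehat\gamma_i=\frac{\lambda^2}{n^2p_i}\frac1{\eta-\rho}\max\big(0,1-\frac{np_i\mu}{L_i}\big)\Big(1+\sqrt{\frac{\eta-\rho}{\eta}}\Big)$. (ii) If instead $\max_i\frac{L_i}{np_i}=\mu$, then the same holds with $\nu=\mu$ and $\widehat\gamma_i=0$ for all $i$, and with the restriction $\rho\in(0,\eta)$ replaced by $\rho\in(0,1]$; that is, if $\rho=\mu\lambda(2-\mu\lambda)\in(0,1]$, then $\mathbb{E}\|x^k-x^\star\|^2\in\mathcal{O}((1-\rho)^k)$.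
   Context: Problem Properties: $g:\mathbb{R}^N\to\mathbb{R}\cup\{\infty\}$ is closed, convex and proper. For every $i\in\{1,\dots,n\}$, $f_i:\mathbb{R}^N\to\mathbb{R}$ is convex, differentiable and $L_i$-smooth. $F=\frac1n\sum_{i=1}^n f_i$ is $\mu$-strongly convex, differentiable and $L$-smooth with $L\le\frac1n\sum_{i=1}^nL_i$. Here a convex $f$ is $L$-smooth ($L>0$) if it is differentiable and $\langle\nabla f(x)-\nabla f(y),x-y\rangle\ge\frac1L\|\nabla f(x)-\nabla f(y)\|^2$ for all $x,y$ (equivalently, $\nabla f$ is $L$-Lipschitz), and $f$ is $\mu$-strongly convex ($\mu>0$) if $f-\frac\mu2\|\cdot\|^2$ is convex. Consequently $g+F$ has a unique minimizer $x^\star$. The norm is Euclidean, and $\operatorname{prox}_{\lambda g}(z)=\arg\min_x \lambda g(x)+\frac12\|x-z\|^2$. PVRSG algorithm: given initial points $x^0,y_1^0,\dots,y_n^0\in\mathbb{R}^N$ and step-size $\lambda>0$, for $k=0,1,\dots$ randomly sample $(I^k,U_1^k,\dots,U_n^k)\in\{1,\dots,n\}\times\{0,1\}^n$ and set $$z^{k+1}=x^k-\tfrac{\lambda}{n}\Big(\tfrac1{p_{I^k}}(\nabla f_{I^k}(x^k)-y_{I^k}^k)+\sum_{i=1}^ny_i^k\Big),\quad x^{k+1}=\operatorname{prox}_{\lambda g}(z^{k+1}),$$ $$y_i^{k+1}=y_i^k+U_i^k(\nabla f_i(x^k)-y_i^k),\quad i=1,\dots,n.$$ The samples for different $k$ are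 independent and identically distributed (within one $k$ the joint law is arbitrary), with $P(I^k=i)=p_i>0$ and expected update frequency $\eta_i=\mathbb{E}[U_i^k]>0$ for all $i$ (by independence equal to the expectation conditioned on the history up to iteration $k$). Coherent Dual Update assumption: there is $\hat x\in\mathbb{R}^N$ with $y_i^0=\nabla f_i(\hat x)$ for all $i$, and $U_1^k=U_2^k=\dots=U_n^k$ for all $k\ge0$. Then $\eta_1=\dots=\eta_n=:\eta$. *)

theory Defs
  imports "HOL-Probability.Probability" "HOL-Library.Landau_Symbols"
begin

section \<open>Convex functions\<close>

text \<open>Functions with values in \<open>\<real> \<union> {\<infinity>}\<close> are \<^typ>\<open>ereal\<close>-valued; properness excludes the value
  \<open>-\<infinity>\<close>. The constant \<^const>\<open>epigraph\<close> covers real-valued functions only.\<close>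

definition ereal_epigraph :: "('a \<Rightarrow> ereal) \<Rightarrow> ('a \<times> real) set" where
  "ereal_epigraph g = {(x, r). g x \<le> ereal r}"

definition proper_fun :: "('a \<Rightarrow> ereal) \<Rightarrow> bool" where
  "proper_fun g \<longleftrightarrow> (\<forall>x. g x \<noteq> -\<infinity>) \<and> (\<exists>x. g x \<noteq> \<infinity>)"

definition closed_convex_proper :: "('a::euclidean_space \<Rightarrow> ereal) \<Rightarrow> bool" where
  "closed_convex_proper g \<longleftrightarrow>
     closed (ereal_epigraph g) \<and> convex (ereal_epigraph g) \<and> proper_fun g"

text \<open>Only meaningful where \<open>f\<close> is differentiable.\<close>

definition gradient :: "('a::euclidean_space \<Rightarrow> real) \<Rightarrow> 'a \<Rightarrow> 'a" where
  "gradient f x = (THE D. GDERIV f x :> D)"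

definition L_smooth :: "real \<Rightarrow> ('a::euclidean_space \<Rightarrow> real) \<Rightarrow> bool" where
  "L_smooth L f \<longleftrightarrow> L > 0 \<and> (\<forall>x. f differentiable (at x)) \<and>
     (\<forall>x y. (gradient f x - gradient f y) \<bullet> (x - y)
              \<ge> 1 / L * (norm (gradient f x - gradient f y))\<^sup>2)"

definition strongly_convex :: "real \<Rightarrow> ('a::euclidean_space \<Rightarrow> real) \<Rightarrow> bool" where
  "strongly_convex \<mu> f \<longleftrightarrow> \<mu> > 0 \<and> convex_on UNIV (\<lambda>x. f x - \<mu> / 2 * (norm x)\<^sup>2)"

text \<open>The minimizers below exist and are unique when \<open>g\<close> is closed, convex and proper, \<open>lam > 0\<close>
  and \<open>F\<close> is strongly convex and differentiable, so the choice made by \<^const>\<open>arg_min\<close> is then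
  immaterial.\<close>

definition prox :: "real \<Rightarrow> ('a::euclidean_space \<Rightarrow> ereal) \<Rightarrow> 'a \<Rightarrow> 'a" where
  "prox lam g z = (ARG_MIN (\<lambda>x. ereal lam * g x + ereal (1 / 2 * (norm (x - z))\<^sup>2)) x. True)"

definition solution :: "('a::euclidean_space \<Rightarrow> ereal) \<Rightarrow> ('a \<Rightarrow> real) \<Rightarrow> 'a" where
  "solution g F = (ARG_MIN (\<lambda>x. g x + ereal (F x)) x. True)"

definition mean_fun :: "nat \<Rightarrow> (nat \<Rightarrow> 'a \<Rightarrow> real) \<Rightarrow> 'a \<Rightarrow> real" where
  "mean_fun n f x = 1 / real n * (\<Sum>i=1..n. f i x)"

section \<open>The PVRSG algorithm\<close>

text \<open>The iterates \<open>(x\<^sup>k, y\<^sup>k)\<close> are computed along one realization \<open>I\<close>, \<open>U\<close> of the samples, where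
  \<open>I k\<close> and \<open>U k i\<close> are the index and the update indicators drawn in iteration \<open>k\<close>. Entries of the
  families \<open>f\<close>, \<open>y\<close>, \<open>p\<close> and \<open>U k\<close> outside \<open>{1..n}\<close> are irrelevant.\<close>

definition pvrsg_step :: "nat \<Rightarrow> (nat \<Rightarrow> 'a::euclidean_space \<Rightarrow> real) \<Rightarrow> ('a \<Rightarrow> ereal) \<Rightarrow> real
    \<Rightarrow> (nat \<Rightarrow> real) \<Rightarrow> nat \<Rightarrow> (nat \<Rightarrow> real) \<Rightarrow> 'a \<times> (nat \<Rightarrow> 'a) \<Rightarrow> 'a \<times> (nat \<Rightarrow> 'a)" where
  "pvrsg_step n f g lam p j u = (\<lambda>(x, y).
     let z = x - (lam / real n) *\<^sub>R
               ((1 / p j) *\<^sub>R (gradient (f j) x - y j) + (\<Sum>i=1..n. y i))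
     in (prox lam g z, \<lambda>i. y i + u i *\<^sub>R (gradient (f i) x - y i)))"

primrec pvrsg :: "nat \<Rightarrow> (nat \<Rightarrow> 'a::euclidean_space \<Rightarrow> real) \<Rightarrow> ('a \<Rightarrow> ereal) \<Rightarrow> real
    \<Rightarrow> (nat \<Rightarrow> real) \<Rightarrow> 'a \<Rightarrow> (nat \<Rightarrow> 'a) \<Rightarrow> (nat \<Rightarrow> nat) \<Rightarrow> (nat \<Rightarrow> nat \<Rightarrow> real)
    \<Rightarrow> nat \<Rightarrow> 'a \<times> (nat \<Rightarrow> 'a)" where
  "pvrsg n f g lam p x0 y0 I U 0 = (x0, y0)"
| "pvrsg n f g lam p x0 y0 I U (Suc k) =
     pvrsg_step n f g lam p (I k) (U k) (pvrsg n f g lam p x0 y0 I U k)"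

definition sample_space :: "nat \<Rightarrow> (nat \<times> (nat \<Rightarrow> real)) set" where
  "sample_space n = {1..n} \<times> ({1..n} \<rightarrow>\<^sub>E {0, 1})"

definition pvrsg_sample :: "nat \<Rightarrow> (nat \<Rightarrow> 'w \<Rightarrow> nat) \<Rightarrow> (nat \<Rightarrow> nat \<Rightarrow> 'w \<Rightarrow> real)
    \<Rightarrow> nat \<Rightarrow> 'w \<Rightarrow> nat \<times> (nat \<Rightarrow> real)" where
  "pvrsg_sample n I U k \<omega> = (I k \<omega>, \<lambda>i\<in>{1..n}. U k i \<omega>)"

text \<open>Independence is required across iterations only; the joint law within an iteration is
  arbitrary. Independence includes measurability, so each sample takes values in the finite set
  \<^const>\<open>sample_space\<close>; hence real functions of finitely many samples are bounded and integrable.\<close>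

definition pvrsg_sampling :: "'w measure \<Rightarrow> nat \<Rightarrow> (nat \<Rightarrow> real) \<Rightarrow> (nat \<Rightarrow> real)
    \<Rightarrow> (nat \<Rightarrow> 'w \<Rightarrow> nat) \<Rightarrow> (nat \<Rightarrow> nat \<Rightarrow> 'w \<Rightarrow> real) \<Rightarrow> bool" where
  "pvrsg_sampling M n p \<eta> I U \<longleftrightarrow>
     prob_space M \<and>
     prob_space.indep_vars M (\<lambda>_. count_space (sample_space n)) (pvrsg_sample n I U) UNIV \<and>
     (\<forall>k. distr M (count_space (sample_space n)) (pvrsg_sample n I U k)
        = distr M (count_space (sample_space n)) (pvrsg_sample n I U 0)) \<and>
     (\<forall>k. \<forall>i\<in>{1..n}. measure M {\<omega> \<in> space M. I k \<omega> = i} = p i \<and> p i > 0) \<and>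
     (\<forall>k. \<forall>i\<in>{1..n}. (\<integral>\<omega>. U k i \<omega> \<partial>M) = \<eta> i \<and> \<eta> i > 0)"

definition coherent_dual_update :: "'w measure \<Rightarrow> nat \<Rightarrow> (nat \<Rightarrow> 'a::euclidean_space \<Rightarrow> real)
    \<Rightarrow> (nat \<Rightarrow> 'a) \<Rightarrow> (nat \<Rightarrow> nat \<Rightarrow> 'w \<Rightarrow> real) \<Rightarrow> bool" where
  "coherent_dual_update M n f y0 U \<longleftrightarrow>
     (\<exists>xhat. \<forall>i\<in>{1..n}. y0 i = gradient (f i) xhat) \<and>
     (\<forall>k. AE \<omega> in M. \<forall>i\<in>{1..n}. \<forall>j\<in>{1..n}. U k i \<omega> = U k j \<omega>)"

end

theory Submission
  imports Defs
begin

text \<open>The proof is a Lyapunov argument for a variance-reduced proximal gradient method.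

Because of coherent updates, all stored vectors are at every time the component gradients at one common
point \<open>w\<close>, the last iterate at which an update took place (initially \<open>xhat\<close>). The run is therefore a random iteration of
pairs \<open>(x, w)\<close>, driven by independent samples with finitely many values, and it suffices to show that
the energy \<open>V(x, w)\<close>, the squared distance of \<open>x\<close> to the solution plus a weighted sum of the squared
differences of component gradients between \<open>w\<close> and the solution, contracts in expectation by the factor
\<open>1 - \<rho>\<close> from every fixed state (\<open>iterate_with_independent_noise_contracts\<close>).

For one step, the proximal map is removed first: the new point is no farther from the solution than the
argument of the proximal map is from a gradient step at the solution (\<open>prox_step_distance\<close>). What
remains is a step along an unbiased estimator of the gradient difference \<open>A = grad F(x) - grad F(x*)\<close>. Its mean
square is \<open>(norm A)\<^sup>2\<close> plus a variance, which Young's inequality splits into a part at \<open>x\<close> and a part at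
the snapshot (\<open>control_variate_step\<close>). Cocoercivity of the component gradients and strong convexity of
\<open>F\<close> bound both parts by sums whose weights \<open>max 0 (1 - n p\<^sub>i \<mu> / L\<^sub>i) / (n\<^sup>2 p\<^sub>i)\<close> are, up to a common factor,
those of the energy (\<open>cocoercive_variance_bounds\<close>). For the snapshot part this uses that the stored
vectors are gradients at one point, which is where coherence enters a second time.

With probability \<open>\<eta>\<close> the snapshot is renewed, so the expected dual energy is the mixture of its values
at \<open>x\<close> and \<open>w\<close>. The common factor is chosen such that the value at \<open>w\<close> absorbs the snapshot variance
and still shrinks by \<open>1 - \<rho>\<close>. Everything at \<open>x\<close> is bounded by \<open>\<nu>\<close> times \<open>A \<bullet> (x - x*)\<close>, and
\<open>A \<bullet> (x - x*) \<ge> \<mu> (norm (x - x*))\<^sup>2\<close> turns the decrease \<open>lam (2 - \<nu> lam)\<close> into the rate \<open>\<rho>\<close>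
(\<open>contraction_arithmetic\<close>). When \<open>m = \<mu>\<close>, all weights vanish and no variance is left.\<close>

section \<open>Gradients of convex functions\<close>

text \<open>One-sided bounds on difference quotients pass to the gradient. Both the tangent inequality for strongly
convex functions and the optimality condition for minimizers follow from this by comparing values
along a segment.\<close>

lemma gderiv_ge_of_difference_quotients:
  fixes h :: "'a::real_inner \<Rightarrow> real"
  assumes h: "GDERIV h u :> d"
    and le: "\<And>t. 0 < t \<Longrightarrow> t < 1 \<Longrightarrow> c * t \<le> h (u + t *\<^sub>R v) - h u"
  shows "c \<le> d \<bullet> v"
proof -
  have "((\<lambda>t. h (u + t *\<^sub>R v)) has_derivative (\<lambda>t. (t *\<^sub>R v) \<bullet> d)) (at 0)"
  proof (rule has_derivative_compose[where g = h])
    show "((\<lambda>t. u + t *\<^sub>R v) has_derivative (\<lambda>t. t *\<^sub>R v)) (at 0)"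
      by (auto intro!: derivative_eq_intros)
    show "(h has_derivative (\<lambda>w. w \<bullet> d)) (at (u + 0 *\<^sub>R v))"
      using h by (simp add: gderiv_def)
  qed
  then have "((\<lambda>t. h (u + t *\<^sub>R v)) has_field_derivative (d \<bullet> v)) (at 0)"
    by (simp add: has_field_derivative_def inner_commute mult_commute_abs)
  then have "((\<lambda>t. (h (u + t *\<^sub>R v) - h u) / t) \<longlongrightarrow> d \<bullet> v) (at_right 0)"
    by (auto simp: has_field_derivative_iff intro: tendsto_mono[OF at_le])
  moreover have "eventually (\<lambda>t. c \<le> (h (u + t *\<^sub>R v) - h u) / t) (at_right 0)"
    unfolding eventually_at_right[OF zero_less_one]
    by (rule exI[of _ 1]) (auto simp: le_divide_eq intro: le)
  ultimately show ?thesis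
    by (intro tendsto_lowerbound) auto
qed

lemma gradient_works:
  fixes f :: "'a::euclidean_space \<Rightarrow> real"
  assumes "f differentiable (at x)"
  shows "GDERIV f x :> gradient f x"
proof -
  obtain f' where f': "(f has_derivative f') (at x)"
    using assms by (auto simp: differentiable_def)
  then have "linear f'" by (rule has_derivative_linear)
  have "f' h = h \<bullet> (\<Sum>b\<in>Basis. f' b *\<^sub>R b)" for h
  proof -
    have "f' h = f' (\<Sum>b\<in>Basis. (h \<bullet> b) *\<^sub>R b)" by (simp add: euclidean_representation)
    also have "\<dots> = (\<Sum>b\<in>Basis. (h \<bullet> b) * f' b)"
      using \<open>linear f'\<close> by (simp add: linear_sum linear_cmul)
    finally show ?thesis by (simp add: inner_sum_right mult.commute)
  qed
  then have "f' = (\<lambda>h. h \<bullet> (\<Sum>b\<in>Basis. f' b *\<^sub>R b))" by (rule ext)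
  then have ex: "GDERIV f x :> (\<Sum>b\<in>Basis. f' b *\<^sub>R b)"
    using f' by (simp add: gderiv_def)
  have "D = D'" if "GDERIV f x :> D" "GDERIV f x :> D'" for D D'
  proof -
    have "(\<lambda>h. h \<bullet> D) = (\<lambda>h. h \<bullet> D')"
      using that has_derivative_unique by (auto simp: gderiv_def)
    then show ?thesis by (metis inner_commute vector_eq_rdot)
  qed
  with ex show ?thesis
    unfolding gradient_def by (metis (no_types, lifting) theI)
qed

lemma strongly_convexD:
  assumes "strongly_convex \<mu> h" "0 \<le> t" "t \<le> 1"
  shows "h (x + t *\<^sub>R (y - x)) \<le> (1 - t) * h x + t * h y - \<mu> / 2 * t * (1 - t) * (norm (y - x))\<^sup>2"
proof -
  have eq: "(1 - t) *\<^sub>R x + t *\<^sub>R y = x + t *\<^sub>R (y - x)" by (simp add: algebra_simps)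
  have "h (x + t *\<^sub>R (y - x)) - \<mu> / 2 * (norm (x + t *\<^sub>R (y - x)))\<^sup>2
      \<le> (1 - t) * (h x - \<mu> / 2 * (norm x)\<^sup>2) + t * (h y - \<mu> / 2 * (norm y)\<^sup>2)"
    using convex_onD[of UNIV "\<lambda>x. h x - \<mu> / 2 * (norm x)\<^sup>2" t x y] assms
    unfolding strongly_convex_def eq by auto
  moreover have N: "(norm (x + t *\<^sub>R (y - x)))\<^sup>2
      = (1 - t) * (norm x)\<^sup>2 + t * (norm y)\<^sup>2 - t * (1 - t) * (norm (y - x))\<^sup>2"
    unfolding power2_norm_eq_inner
    by (simp add: inner_simps inner_commute algebra_simps power2_eq_square)
  ultimately show ?thesis unfolding N by (simp add: field_simps)
qed

text \<open>Adding the two tangent inequalities at \<open>x\<close> and \<open>y\<close> gives monotonicity of the gradient with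
modulus \<open>\<mu>\<close>.\<close>

lemma strongly_convex_gradient_monotone:
  assumes "strongly_convex \<mu> h" "GDERIV h x :> d" "GDERIV h y :> e"
  shows "\<mu> * (norm (x - y))\<^sup>2 \<le> (d - e) \<bullet> (x - y)"
proof -
  have tangent: "h u + d \<bullet> (v - u) + \<mu> / 2 * (norm (v - u))\<^sup>2 \<le> h v" if d: "GDERIV h u :> d" for u v d
  proof -
    \<comment> \<open>The square of the distance to \<open>u\<close> has zero gradient at \<open>u\<close>; adding it cancels the
      second-order term in \<open>t\<close> and leaves difference quotients with a constant bound.\<close>
    let ?N = "(norm (v - u))\<^sup>2"
    define k where "k = (\<lambda>w. - h w + \<mu> / 2 * ((w - u) \<bullet> (w - u)))"
    have "GDERIV k u :> - d"
      unfolding k_def gderiv_def using d[unfolded gderiv_def]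
      by (auto intro!: derivative_eq_intros simp: inner_commute)
    then have "h u - h v + \<mu> / 2 * ?N \<le> - d \<bullet> (v - u)"
    proof (rule gderiv_ge_of_difference_quotients)
      fix t :: real assume t: "0 < t" "t < 1"
      have "h (u + t *\<^sub>R (v - u)) \<le> (1 - t) * h u + t * h v - \<mu> / 2 * t * (1 - t) * ?N"
        using strongly_convexD[OF assms(1), of t u v] t by simp
      moreover have "k (u + t *\<^sub>R (v - u)) - k u = h u - h (u + t *\<^sub>R (v - u)) + \<mu> / 2 * t\<^sup>2 * ?N"
        unfolding k_def by (simp add: dot_square_norm power_mult_distrib)
      ultimately show "(h u - h v + \<mu> / 2 * ?N) * t \<le> k (u + t *\<^sub>R (v - u)) - k u"
        by (simp add: field_simps power2_eq_square)
    qed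
    then show ?thesis by (simp add: inner_simps)
  qed
  have "h x + d \<bullet> (y - x) + \<mu> / 2 * (norm (y - x))\<^sup>2 \<le> h y" "h y + e \<bullet> (x - y) + \<mu> / 2 * (norm (x - y))\<^sup>2 \<le> h x"
    using tangent assms(2,3) by blast+
  then show ?thesis
    by (simp add: inner_simps norm_minus_commute algebra_simps)
qed

section \<open>Minimizers and proximal steps\<close>

text \<open>A closed epigraph means that all sublevel sets are closed. On a compact set the nonempty ones form a
nested family of compact sets, so they have a common point, and such a point is a minimizer.\<close>

lemma attains_min_on_compact_of_closed_epigraph:
  fixes \<phi> :: "'a::t2_space \<Rightarrow> ereal"
  assumes "closed (ereal_epigraph \<phi>)" "compact K" "K \<noteq> {}"
  shows "\<exists>u\<in>K. \<forall>y\<in>K. \<phi> u \<le> \<phi> y"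
proof -
  let ?S = "\<lambda>r. {x. \<phi> x \<le> ereal r}"
  define J where "J = {r. K \<inter> ?S r \<noteq> {}}"
  have "closed (?S r)" for r
  proof -
    have "?S r = (\<lambda>x. (x, r)) -` ereal_epigraph \<phi>"
      by (auto simp: ereal_epigraph_def)
    moreover have "closed ((\<lambda>x. (x, r)) -` ereal_epigraph \<phi>)"
      using assms(1) by (intro closed_vimage) (auto intro: continuous_intros)
    ultimately show ?thesis by simp
  qed
  moreover have "K \<inter> (\<Inter>r\<in>J'. ?S r) \<noteq> {}" if J': "finite J'" "J' \<subseteq> J" for J'
  proof (cases "J' = {}")
    case False
    then have "Min J' \<in> J" using J' by (meson Min_in subsetD)
    then obtain x where x: "x \<in> K" "\<phi> x \<le> ereal (Min J')" by (auto simp: J_def)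
    then have "\<phi> x \<le> ereal r" if "r \<in> J'" for r
      using that J' False by (meson Min_le ereal_less_eq(3) order_trans)
    with x show ?thesis by auto
  qed (use assms(3) in auto)
  ultimately have "K \<inter> (\<Inter>r\<in>J. ?S r) \<noteq> {}"
    by (rule compact_imp_fip_image[OF assms(2)])
  then obtain u where u: "u \<in> K" "\<And>r. r \<in> J \<Longrightarrow> \<phi> u \<le> ereal r" by auto
  have "\<phi> u \<le> \<phi> y" if "y \<in> K" for y
  proof (rule ereal_le_real)
    fix r assume "\<phi> y \<le> ereal r"
    then show "\<phi> u \<le> ereal r" using that u(2) by (auto simp: J_def)
  qed
  with u(1) show ?thesis by blast
qed

lemma closed_convex_proper_finite_point:
  assumes "closed_convex_proper g"
  obtains x a where "g x = ereal a"
proof -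
  from assms obtain x where "g x \<noteq> \<infinity>" "g x \<noteq> -\<infinity>"
    by (auto simp: closed_convex_proper_def proper_fun_def)
  with that show thesis by (cases "g x") auto
qed

lemma convex_epigraphD:
  assumes "convex (ereal_epigraph g)" "g x = ereal a" "g y = ereal b" "0 \<le> t" "t \<le> 1"
  shows "g (x + t *\<^sub>R (y - x)) \<le> ereal ((1 - t) * a + t * b)"
proof -
  have "(x, a) \<in> ereal_epigraph g" "(y, b) \<in> ereal_epigraph g"
    using assms by (auto simp: ereal_epigraph_def)
  then have "(1 - t) *\<^sub>R (x, a) + t *\<^sub>R (y, b) \<in> ereal_epigraph g"
    using assms by (intro convexD) auto
  moreover have "(1 - t) *\<^sub>R x + t *\<^sub>R y = x + t *\<^sub>R (y - x)" by (simp add: algebra_simps)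
  ultimately show ?thesis by (auto simp: ereal_epigraph_def)
qed

lemma closed_epigraph_add_continuous:
  fixes h :: "'a::topological_space \<Rightarrow> real"
  assumes "closed (ereal_epigraph g)" "continuous_on UNIV h"
  shows "closed (ereal_epigraph (\<lambda>x. g x + ereal (h x)))"
proof -
  have "g x + ereal (h x) \<le> ereal r \<longleftrightarrow> g x \<le> ereal (r - h x)" for x r
    by (cases "g x") auto
  then have "ereal_epigraph (\<lambda>x. g x + ereal (h x))
      = (\<lambda>w. (fst w, snd w - h (fst w))) -` ereal_epigraph g"
    by (auto simp: ereal_epigraph_def)
  moreover have "continuous_on UNIV (\<lambda>w::'a \<times> real. (fst w, snd w - h (fst w)))"
    by (intro continuous_intros continuous_on_compose2[OF assms(2)]) auto
  ultimately show ?thesis using assms(1) by (simp add: closed_vimage)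
qed

text \<open>Coercivity comes from strong convexity along segments. The sum is bounded below by some \<open>c\<close> on the unit
ball around a point \<open>x1\<close> of its domain. If \<open>y\<close> lies at distance \<open>d > 1\<close> from \<open>x1\<close>, then the segment
from \<open>x1\<close> to \<open>y\<close> leaves that ball at a point with value at least \<open>c\<close>, and strong convexity along the
segment makes the value at \<open>y\<close> grow quadratically in \<open>d\<close>. Outside a large ball all values are thus at
least the value at \<open>x1\<close>, and on the ball compactness applies.\<close>

lemma closed_convex_proper_plus_strongly_convex_attains_min:
  fixes g :: "'a::euclidean_space \<Rightarrow> ereal"
  assumes g: "closed_convex_proper g" and h: "strongly_convex \<mu> h"
  shows "\<exists>u. \<forall>y. g u + ereal (h u) \<le> g y + ereal (h y)"
proof -
  have "\<mu> > 0" using h by (simp add: strongly_convex_def)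
  define \<phi> where "\<phi> x = g x + ereal (h x)" for x
  have gninf: "g x \<noteq> -\<infinity>" for x
    using g by (simp add: closed_convex_proper_def proper_fun_def)
  have "continuous_on UNIV (\<lambda>x. (h x - \<mu> / 2 * (norm x)\<^sup>2) + \<mu> / 2 * (norm x)\<^sup>2)"
    using h convex_on_continuous[OF open_UNIV, of "\<lambda>x. h x - \<mu> / 2 * (norm x)\<^sup>2"]
    by (intro continuous_on_add continuous_on_mult continuous_on_power continuous_on_norm
          continuous_on_const continuous_on_id) (simp_all add: strongly_convex_def)
  then have "continuous_on UNIV h" by (simp only: diff_add_cancel)
  then have closed: "closed (ereal_epigraph \<phi>)"
    using g closed_epigraph_add_continuous unfolding \<phi>_def closed_convex_proper_def by blast
  obtain x1 a1 where a1: "g x1 = ereal a1"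
    using closed_convex_proper_finite_point[OF g] by blast
  obtain u0 where "u0 \<in> cball x1 1" and u0: "\<And>y. y \<in> cball x1 1 \<Longrightarrow> \<phi> u0 \<le> \<phi> y"
    using attains_min_on_compact_of_closed_epigraph[OF closed, of "cball x1 1"] by auto
  define A where "A = a1 + h x1"
  have A: "\<phi> x1 = ereal A" by (simp add: \<phi>_def A_def a1)
  have "\<phi> u0 \<le> ereal A" using u0[of x1] A by simp
  then obtain c where c: "\<phi> u0 = ereal c" "c \<le> A"
    using gninf[of u0] by (cases "g u0") (auto simp: \<phi>_def)
  \<comment> \<open>Chosen so that \<open>d > R\<close> makes the quadratic gain \<open>\<mu> / 2 * (d - 1) * d\<close> exceed the
    possible linear loss \<open>(A - c) * d\<close>.\<close>
  define R where "R = 1 + 2 * (A - c) / \<mu>"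
  have "R \<ge> 1" using c \<open>\<mu> > 0\<close> by (simp add: R_def)
  have far: "ereal A \<le> \<phi> y" if "norm (y - x1) > R" for y
  proof (cases "g y")
    case (real b)
    define d where "d = norm (y - x1)"
    have "d > 1" using that \<open>R \<ge> 1\<close> by (simp add: d_def)
    define t where "t = 1 / d"
    have t: "0 \<le> t" "t \<le> 1" "t * d = 1" using \<open>d > 1\<close> by (auto simp: t_def)
    let ?w = "x1 + t *\<^sub>R (y - x1)"
    have "?w \<in> cball x1 1" using t by (auto simp: dist_norm d_def)
    then have "ereal c \<le> g ?w + ereal (h ?w)" using u0 c by (auto simp: \<phi>_def)
    also have "\<dots> \<le> ereal ((1 - t) * a1 + t * b)
        + ereal ((1 - t) * h x1 + t * h y - \<mu> / 2 * t * (1 - t) * d\<^sup>2)"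
      using convex_epigraphD[OF _ a1 real t(1,2)] strongly_convexD[OF h t(1,2), of x1 y] g
      by (intro add_mono) (auto simp: closed_convex_proper_def d_def)
    finally have "c \<le> (1 - t) * A + t * (b + h y) - \<mu> / 2 * t * (1 - t) * d\<^sup>2"
      by (simp add: A_def algebra_simps)
    then have "d * c \<le> d * ((1 - t) * A + t * (b + h y) - \<mu> / 2 * t * (1 - t) * d\<^sup>2)"
      using \<open>d > 1\<close> by (intro mult_left_mono) auto
    also have "\<dots> = (d - t * d) * A + (t * d) * (b + h y) - \<mu> / 2 * (t * d) * (d - t * d) * d"
      by (simp add: algebra_simps power2_eq_square)
    finally have "d * c \<le> (d - 1) * A + (b + h y) - \<mu> / 2 * (d - 1) * d" by (simp add: t(3))
    moreover have "d * (A - c) \<le> d * (\<mu> / 2 * (d - 1))"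
      using that \<open>d > 1\<close> \<open>\<mu> > 0\<close> by (intro mult_left_mono) (auto simp: R_def d_def field_simps)
    ultimately have "A \<le> b + h y" by (simp add: field_simps)
    then show ?thesis by (simp add: \<phi>_def real)
  qed (use gninf[of y] in \<open>auto simp: \<phi>_def\<close>)
  obtain u where u: "u \<in> cball x1 R" "\<And>y. y \<in> cball x1 R \<Longrightarrow> \<phi> u \<le> \<phi> y"
    using attains_min_on_compact_of_closed_epigraph[OF closed, of "cball x1 R"] \<open>R \<ge> 1\<close> by auto
  have "\<phi> u \<le> ereal A" using u(2)[of x1] \<open>R \<ge> 1\<close> A by auto
  then have "\<phi> u \<le> \<phi> y" for y
    using far[of y] u(2)[of y] by (cases "norm (y - x1) \<le> R") (auto simp: dist_norm norm_minus_commute)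
  then show ?thesis by (auto simp: \<phi>_def)
qed

text \<open>A minimizer \<open>u\<close> of \<open>g + h\<close> has the negative gradient of \<open>h\<close> as a subgradient of \<open>g\<close>. Moving from \<open>u\<close>
towards \<open>y\<close> changes \<open>g\<close> at most linearly by convexity, hence \<open>h\<close> must grow at least at the opposite
rate. Both values of \<open>g\<close> are named as reals to keep the inequality out of extended arithmetic.\<close>

lemma first_order_optimality:
  assumes g: "closed_convex_proper g"
    and min: "\<And>y. g u + ereal (h u) \<le> g y + ereal (h y)"
    and h: "GDERIV h u :> d"
  obtains a where "g u = ereal a" "\<And>y b. g y = ereal b \<Longrightarrow> a \<le> b + d \<bullet> (y - u)"
proof -
  obtain x1 a1 where "g x1 = ereal a1"
    using closed_convex_proper_finite_point[OF g] by blast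
  then obtain a where a: "g u = ereal a"
    using min[of x1] g by (cases "g u") (auto simp: closed_convex_proper_def proper_fun_def)
  have "a - b \<le> d \<bullet> (y - u)" if b: "g y = ereal b" for y b
    using h
  proof (rule gderiv_ge_of_difference_quotients)
    fix t :: real assume t: "0 < t" "t < 1"
    let ?w = "u + t *\<^sub>R (y - u)"
    have "ereal (a + h u) \<le> g ?w + ereal (h ?w)" using min[of ?w] a by simp
    also have "\<dots> \<le> ereal ((1 - t) * a + t * b) + ereal (h ?w)"
      using convex_epigraphD[OF _ a b, of t] g t
      by (intro add_right_mono) (auto simp: closed_convex_proper_def)
    finally show "(a - b) * t \<le> h ?w - h u" by (simp add: algebra_simps)
  qed
  then have "a \<le> b + d \<bullet> (y - u)" if "g y = ereal b" for y b
    using that by (simp add: algebra_simps)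
  then show thesis by (rule that[OF a])
qed

lemma closed_convex_proper_scale:
  fixes g :: "'a::euclidean_space \<Rightarrow> ereal"
  assumes g: "closed_convex_proper g" and "lam > 0"
  shows "closed_convex_proper (\<lambda>x. ereal lam * g x)"
proof -
  have "ereal lam * g x \<le> ereal r \<longleftrightarrow> g x \<le> ereal (r / lam)" for x r
    using \<open>lam > 0\<close> by (cases "g x") (auto simp: field_simps)
  then have eq: "ereal_epigraph (\<lambda>x. ereal lam * g x) = (\<lambda>w. (fst w, snd w / lam)) -` ereal_epigraph g"
    by (auto simp: ereal_epigraph_def)
  have "linear (\<lambda>w::'a \<times> real. (fst w, snd w / lam))"
    by (auto intro!: linearI simp: add_divide_distrib)
  moreover have "continuous_on UNIV (\<lambda>w::'a \<times> real. (fst w, snd w / lam))"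
    using \<open>lam > 0\<close> by (intro continuous_intros) auto
  moreover have "proper_fun (\<lambda>x. ereal lam * g x)"
  proof -
    obtain x1 where "g x1 \<noteq> \<infinity>" using g by (auto simp: closed_convex_proper_def proper_fun_def)
    then have "ereal lam * g x1 \<noteq> \<infinity>" using \<open>lam > 0\<close> by (cases "g x1") auto
    moreover have "ereal lam * g x \<noteq> -\<infinity>" for x
      using g \<open>lam > 0\<close> by (cases "g x") (auto simp: closed_convex_proper_def proper_fun_def)
    ultimately show ?thesis by (auto simp: proper_fun_def)
  qed
  ultimately show ?thesis
    using g unfolding closed_convex_proper_def eq
    by (intro conjI closed_vimage convex_linear_vimage) simp_all
qed

lemma arg_min_True_le:
  fixes F :: "'a \<Rightarrow> 'b::linorder"
  assumes "\<exists>u. \<forall>y. F u \<le> F y"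
  shows "F (ARG_MIN F x. True) \<le> F y"
proof -
  from assms obtain u where u: "\<And>y. F u \<le> F y" by blast
  then have "F (ARG_MIN F x. True) = F u" by (intro arg_min_equality) auto
  with u show ?thesis by simp
qed

text \<open>This combines the fixed-point equation \<open>x* = prox (x* - lam d)\<close> with nonexpansiveness of the proximal
map: adding the subgradient inequality at the proximal point, tested at the solution, to the one at the
solution, tested at the proximal point, eliminates the values of \<open>g\<close>.\<close>

lemma prox_step_distance:
  fixes g :: "'a::euclidean_space \<Rightarrow> ereal"
  assumes g: "closed_convex_proper g" and lam: "lam > 0"
    and F: "strongly_convex \<mu> F" "GDERIV F (solution g F) :> d"
  shows "norm (prox lam g z - solution g F) \<le> norm (z - (solution g F - lam *\<^sub>R d))"
proof -
  let ?s = "solution g F" and ?u = "prox lam g z"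
  define q where "q x = 1 / 2 * (norm (x - z))\<^sup>2" for x
  have "(\<lambda>x. q x - 1 / 2 * (norm x)\<^sup>2) = (\<lambda>x. (norm z)\<^sup>2 / 2 - z \<bullet> x)"
    unfolding q_def power2_norm_eq_inner by (simp add: fun_eq_iff inner_simps inner_commute algebra_simps)
  moreover have "convex_on UNIV (\<lambda>x. (norm z)\<^sup>2 / 2 - z \<bullet> x)"
    by (rule convex_onI) (auto simp: inner_simps field_simps)
  ultimately have "strongly_convex 1 q" by (simp add: strongly_convex_def)
  then have "ereal lam * g ?u + ereal (q ?u) \<le> ereal lam * g y + ereal (q y)" for y
    unfolding prox_def q_def
    by (intro arg_min_True_le closed_convex_proper_plus_strongly_convex_attains_min[OF closed_convex_proper_scale])
       (auto simp: g lam)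
  moreover have "GDERIV q ?u :> ?u - z"
    unfolding q_def gderiv_def power2_norm_eq_inner
    by (auto intro!: derivative_eq_intros simp: inner_commute)
  ultimately obtain a' where a': "ereal lam * g ?u = ereal a'"
    "\<And>y b. ereal lam * g y = ereal b \<Longrightarrow> a' \<le> b + (?u - z) \<bullet> (y - ?u)"
    by (rule first_order_optimality[OF closed_convex_proper_scale[OF g lam]]) blast
  have "g ?s + ereal (F ?s) \<le> g y + ereal (F y)" for y
    unfolding solution_def
    by (intro arg_min_True_le closed_convex_proper_plus_strongly_convex_attains_min[OF g F(1)])
  then obtain a where a: "g ?s = ereal a" "\<And>y b. g y = ereal b \<Longrightarrow> a \<le> b + d \<bullet> (y - ?s)"
    by (rule first_order_optimality[OF g _ F(2)]) blast
  obtain c where c: "g ?u = ereal c" "a' = lam * c"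
    using a'(1) lam by (cases "g ?u") auto
  have "lam * c \<le> lam * a + (?u - z) \<bullet> (?s - ?u)" using a'(2)[of ?s] a c by simp
  moreover have "lam * a \<le> lam * (c + d \<bullet> (?u - ?s))" using a(2)[OF c(1)] lam by simp
  ultimately have "(?u - ?s) \<bullet> (?u - ?s) \<le> (z - (?s - lam *\<^sub>R d)) \<bullet> (?u - ?s)"
    by (simp add: inner_simps inner_commute algebra_simps)
  also have "\<dots> \<le> norm (z - (?s - lam *\<^sub>R d)) * norm (?u - ?s)" by (rule norm_cauchy_schwarz)
  finally show ?thesis
    by (cases "?u = ?s") (auto simp: dot_square_norm power2_eq_square)
qed

section \<open>Variance of a gradient estimator with control variate\<close>

lemma norm_square_diff_Young:
  fixes u v :: "'a::real_inner"
  assumes "s > 0"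
  shows "(norm (u - v))\<^sup>2 \<le> (1 + s) * (norm u)\<^sup>2 + (1 + 1 / s) * (norm v)\<^sup>2"
proof -
  have "0 \<le> (1 / s) * (norm (s *\<^sub>R u + v))\<^sup>2" using assms by simp
  also have "\<dots> = s * (norm u)\<^sup>2 + 2 * (u \<bullet> v) + (1 / s) * (norm v)\<^sup>2"
    unfolding power2_norm_eq_inner using assms
    by (simp add: inner_simps inner_commute field_simps)
  finally show ?thesis
    unfolding power2_norm_eq_inner by (simp add: inner_simps inner_commute algebra_simps)
qed

lemma weighted_variance:
  fixes q :: "'i \<Rightarrow> 'a::real_inner"
  assumes "(\<Sum>i\<in>J. p i) = 1" "(\<Sum>i\<in>J. p i *\<^sub>R q i) = A"
  shows "(\<Sum>i\<in>J. p i * (norm (q i - A))\<^sup>2) = (\<Sum>i\<in>J. p i * (norm (q i))\<^sup>2) - (norm A)\<^sup>2"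
proof -
  have "(\<Sum>i\<in>J. p i * (norm (q i - A))\<^sup>2)
      = (\<Sum>i\<in>J. p i * (norm (q i))\<^sup>2 - 2 * ((p i *\<^sub>R q i) \<bullet> A) + p i * (A \<bullet> A))"
    unfolding power2_norm_eq_inner by (simp add: inner_simps inner_commute algebra_simps)
  also have "\<dots> = (\<Sum>i\<in>J. p i * (norm (q i))\<^sup>2) - 2 * ((\<Sum>i\<in>J. p i *\<^sub>R q i) \<bullet> A) + (\<Sum>i\<in>J. p i) * (A \<bullet> A)"
    by (simp add: sum.distrib sum_subtractf inner_sum_left sum_distrib_left sum_distrib_right)
  finally show ?thesis using assms by (simp add: power2_norm_eq_inner)
qed

text \<open>The random direction \<open>q i - r i + B\<close> has mean \<open>A\<close> for every control variate \<open>r\<close> with mean \<open>B\<close>. Only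
the deviation from \<open>A\<close> is split by Young's inequality, so that \<open>A\<close> itself is not inflated; the
resulting negative term \<open>- s * (norm A)\<^sup>2\<close> is where strong convexity will lower the variance.\<close>

lemma control_variate_step:
  fixes q r :: "'i \<Rightarrow> 'a::real_inner"
  assumes p: "(\<Sum>i\<in>J. p i) = 1" "\<And>i. i \<in> J \<Longrightarrow> p i > 0"
    and q: "(\<Sum>i\<in>J. p i *\<^sub>R q i) = A" and r: "(\<Sum>i\<in>J. p i *\<^sub>R r i) = B" and "s > 0"
  shows "(\<Sum>i\<in>J. p i * (norm (X - lam *\<^sub>R (q i - r i + B)))\<^sup>2)
     \<le> (norm X)\<^sup>2 - 2 * lam * (A \<bullet> X)
       + lam\<^sup>2 * ((1 + s) * (\<Sum>i\<in>J. p i * (norm (q i))\<^sup>2) - s * (norm A)\<^sup>2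
                 + (1 + 1 / s) * ((\<Sum>i\<in>J. p i * (norm (r i))\<^sup>2) - (norm B)\<^sup>2))"
proof -
  define e where "e i = q i - r i + B" for i
  have e: "(\<Sum>i\<in>J. p i *\<^sub>R e i) = A"
    unfolding e_def using q r p(1)
    by (simp add: scaleR_add_right scaleR_diff_right sum.distrib sum_subtractf flip: scaleR_sum_left)
  have dev: "e i - A = (q i - A) - (r i - B)" for i by (simp add: e_def)
  have expand: "(\<Sum>i\<in>J. p i * (norm (X - lam *\<^sub>R e i))\<^sup>2)
      = (norm X)\<^sup>2 - 2 * lam * (A \<bullet> X) + lam\<^sup>2 * (\<Sum>i\<in>J. p i * (norm (e i))\<^sup>2)"
  proof -
    have "(\<Sum>i\<in>J. p i * (norm (X - lam *\<^sub>R e i))\<^sup>2)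
        = (\<Sum>i\<in>J. p i * (norm X)\<^sup>2 - 2 * lam * ((p i *\<^sub>R e i) \<bullet> X) + lam\<^sup>2 * (p i * (norm (e i))\<^sup>2))"
      unfolding power2_norm_eq_inner
      by (simp add: inner_simps inner_commute algebra_simps power2_eq_square)
    also have "\<dots> = (norm X)\<^sup>2 - 2 * lam * (A \<bullet> X) + lam\<^sup>2 * (\<Sum>i\<in>J. p i * (norm (e i))\<^sup>2)"
      by (simp add: sum.distrib sum_subtractf p(1) e flip: sum_distrib_left sum_distrib_right inner_sum_left
          del: inner_scaleR_left)
    finally show ?thesis .
  qed
  have "(\<Sum>i\<in>J. p i * (norm (e i - A))\<^sup>2)
      \<le> (\<Sum>i\<in>J. p i * ((1 + s) * (norm (q i - A))\<^sup>2 + (1 + 1 / s) * (norm (r i - B))\<^sup>2))"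
    unfolding dev using p(2) \<open>s > 0\<close>
    by (intro sum_mono mult_left_mono norm_square_diff_Young) (auto simp: less_imp_le)
  also have "\<dots> = (1 + s) * (\<Sum>i\<in>J. p i * (norm (q i - A))\<^sup>2)
               + (1 + 1 / s) * (\<Sum>i\<in>J. p i * (norm (r i - B))\<^sup>2)"
    by (simp only: distrib_left sum.distrib sum_distrib_left mult.left_commute)
  also have "\<dots> = (1 + s) * ((\<Sum>i\<in>J. p i * (norm (q i))\<^sup>2) - (norm A)\<^sup>2)
               + (1 + 1 / s) * ((\<Sum>i\<in>J. p i * (norm (r i))\<^sup>2) - (norm B)\<^sup>2)"
    by (simp only: weighted_variance[OF p(1) q] weighted_variance[OF p(1) r])
  finally have "(\<Sum>i\<in>J. p i * (norm (e i))\<^sup>2)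
      \<le> (1 + s) * (\<Sum>i\<in>J. p i * (norm (q i))\<^sup>2) - s * (norm A)\<^sup>2
        + (1 + 1 / s) * ((\<Sum>i\<in>J. p i * (norm (r i))\<^sup>2) - (norm B)\<^sup>2)"
    unfolding weighted_variance[OF p(1) e] by (simp add: algebra_simps)
  from mult_left_mono[OF this, of "lam\<^sup>2"] show ?thesis
    using expand unfolding e_def by simp
qed

text \<open>The vectors \<open>a i\<close> stand for the differences of component gradients at two points that differ by \<open>X\<close>,
and \<open>T\<close> is the second moment of \<open>a i / (N * p i)\<close> when \<open>i\<close> is drawn with probability \<open>p i\<close>. Strong
convexity of the average is worth a factor
\<open>1 - N * p i * \<mu> / l i\<close> in the variance: it bounds \<open>(norm A)\<^sup>2\<close> from below by \<open>\<mu> * (A \<bullet> X)\<close>, and this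
quantity splits over the components again, where cocoercivity bounds each part from below.\<close>

lemma cocoercive_variance_bounds:
  fixes a :: "'i \<Rightarrow> 'a::real_inner"
  assumes N: "N > 0" and p: "\<And>i. i \<in> J \<Longrightarrow> p i > 0" and l: "\<And>i. i \<in> J \<Longrightarrow> l i > 0"
    and cocoercive: "\<And>i. i \<in> J \<Longrightarrow> (norm (a i))\<^sup>2 \<le> l i * (a i \<bullet> X)"
    and A: "A = (1 / N) *\<^sub>R (\<Sum>i\<in>J. a i)"
    and strong: "\<mu> > 0" "\<mu> * (norm X)\<^sup>2 \<le> A \<bullet> X"
    and m: "\<And>i. i \<in> J \<Longrightarrow> l i / (N * p i) \<le> m" "\<mu> \<le> m"
  defines "T \<equiv> \<Sum>i\<in>J. (norm (a i))\<^sup>2 / (N\<^sup>2 * p i)"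
    and "S \<equiv> \<Sum>i\<in>J. max 0 (1 - N * p i * \<mu> / l i) / (N\<^sup>2 * p i) * (norm (a i))\<^sup>2"
  shows "\<mu> * (A \<bullet> X) \<le> (norm A)\<^sup>2" "T \<le> m * (A \<bullet> X)" "T - (norm A)\<^sup>2 \<le> S"
    "S \<le> (m - \<mu>) * (A \<bullet> X)"
proof -
  have AX: "A \<bullet> X = (\<Sum>i\<in>J. (a i \<bullet> X) / N)"
    by (simp add: A inner_sum_left sum_divide_distrib)
  have aX: "a i \<bullet> X \<ge> 0" if "i \<in> J" for i
    using cocoercive[OF that] l[OF that] by (smt (verit) mult_pos_neg zero_le_power2)
  show strongA: "\<mu> * (A \<bullet> X) \<le> (norm A)\<^sup>2"
  proof (cases "X = 0")
    case False
    have "A \<bullet> X \<le> norm A * norm X" by (rule norm_cauchy_schwarz)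
    with strong(2) have "\<mu> * norm X * norm X \<le> norm A * norm X" by (simp add: power2_eq_square)
    then have "\<mu> * norm X \<le> norm A" using False by simp
    then have "norm A * (\<mu> * norm X) \<le> norm A * norm A" by (intro mult_left_mono) auto
    moreover have "\<mu> * (A \<bullet> X) \<le> \<mu> * (norm A * norm X)"
      using strong(1) norm_cauchy_schwarz by (intro mult_left_mono) auto
    ultimately show ?thesis by (simp add: power2_eq_square algebra_simps)
  qed simp
  have term_le: "(norm (a i))\<^sup>2 / (N\<^sup>2 * p i) \<le> l i / (N * p i) * ((a i \<bullet> X) / N)" if "i \<in> J" for i
    using cocoercive[OF that] p[OF that] N
    by (simp add: field_simps power2_eq_square)
  have "(norm (a i))\<^sup>2 / (N\<^sup>2 * p i) \<le> m * ((a i \<bullet> X) / N)" if "i \<in> J" for i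
    using term_le[OF that] mult_right_mono[OF m(1)[OF that], of "(a i \<bullet> X) / N"] aX[OF that] N by auto
  then show "T \<le> m * (A \<bullet> X)"
    unfolding T_def AX sum_distrib_left by (intro sum_mono)
  \<comment> \<open>The first term is the coefficient of \<open>(norm (a i))\<^sup>2\<close> in \<open>T\<close>; the second is its coefficient in
    the lower bound that cocoercivity gives for the summand of \<open>\<mu> * (A \<bullet> X)\<close>.\<close>
  have factor: "(1 - N * p i * \<mu> / l i) / (N\<^sup>2 * p i) = 1 / (N\<^sup>2 * p i) - \<mu> / (N * l i)" if "i \<in> J" for i
    using p[OF that] l[OF that] N by (simp add: field_simps power2_eq_square)
  have "(norm (a i))\<^sup>2 / (N\<^sup>2 * p i) - \<mu> * ((a i \<bullet> X) / N)
      \<le> max 0 (1 - N * p i * \<mu> / l i) / (N\<^sup>2 * p i) * (norm (a i))\<^sup>2" if i: "i \<in> J" for i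
  proof -
    have "(norm (a i))\<^sup>2 * (\<mu> / (N * l i)) \<le> l i * (a i \<bullet> X) * (\<mu> / (N * l i))"
      using strong(1) l[OF i] N by (intro mult_right_mono cocoercive[OF i]) auto
    also have "\<dots> = \<mu> * ((a i \<bullet> X) / N)" using l[OF i] by simp
    finally have "(norm (a i))\<^sup>2 / (N\<^sup>2 * p i) - \<mu> * ((a i \<bullet> X) / N)
        \<le> (1 - N * p i * \<mu> / l i) / (N\<^sup>2 * p i) * (norm (a i))\<^sup>2"
      unfolding factor[OF i] by (simp add: algebra_simps)
    also have "\<dots> \<le> max 0 (1 - N * p i * \<mu> / l i) / (N\<^sup>2 * p i) * (norm (a i))\<^sup>2"
      using p[OF i] N by (intro mult_right_mono divide_right_mono) auto
    finally show ?thesis .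
  qed
  then have "T - \<mu> * (A \<bullet> X) \<le> S"
    unfolding T_def S_def AX sum_distrib_left sum_subtractf[symmetric] by (intro sum_mono)
  with strongA show "T - (norm A)\<^sup>2 \<le> S" by simp
  have "max 0 (1 - N * p i * \<mu> / l i) / (N\<^sup>2 * p i) * (norm (a i))\<^sup>2 \<le> (m - \<mu>) * ((a i \<bullet> X) / N)"
    if i: "i \<in> J" for i
  proof -
    let ?M = "max 0 (1 - N * p i * \<mu> / l i)"
    have "?M / (N\<^sup>2 * p i) * (norm (a i))\<^sup>2 = ?M * ((norm (a i))\<^sup>2 / (N\<^sup>2 * p i))" by simp
    also have "\<dots> \<le> ?M * (l i / (N * p i) * ((a i \<bullet> X) / N))"
      by (intro mult_left_mono term_le i) auto
    also have "\<dots> = max 0 (l i / (N * p i) - \<mu>) * ((a i \<bullet> X) / N)"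
    proof -
      have "?M * (l i / (N * p i)) = max (0 * (l i / (N * p i))) ((1 - N * p i * \<mu> / l i) * (l i / (N * p i)))"
        using p[OF i] l[OF i] N by (subst max_mult_distrib_right) auto
      also have "\<dots> = max 0 (l i / (N * p i) - \<mu>)"
      proof -
        have "(1 - N * p i * \<mu> / l i) * (l i / (N * p i)) = l i / (N * p i) - \<mu>"
          using p[OF i] l[OF i] N by (simp add: field_simps)
        then show ?thesis by simp
      qed
      finally have M: "?M * (l i / (N * p i)) = max 0 (l i / (N * p i) - \<mu>)" .
      show ?thesis unfolding M[symmetric] by (rule mult.assoc[symmetric])
    qed
    also have "\<dots> \<le> (m - \<mu>) * ((a i \<bullet> X) / N)"
      using m(1)[OF i] m(2) aX[OF i] N by (intro mult_right_mono) auto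
    finally show ?thesis .
  qed
  then show "S \<le> (m - \<mu>) * (A \<bullet> X)"
    unfolding S_def AX sum_distrib_left by (intro sum_mono)
qed

text \<open>The constants of the rate are the solution of two requirements. The factor \<open>C\<close> of the dual energy must
absorb the snapshot variance, \<open>1 + 1 / s + C * (1 - \<eta>) = (1 - \<rho>) * C\<close>. The total weight
\<open>s\<^sup>2 + 2 * s = s + C * \<eta>\<close> of \<open>Sa\<close> should then be as small as possible, which determines the Young
parameter as \<open>s = sqrt (\<eta> / (\<eta> - \<rho>))\<close>; the total coefficient of \<open>D\<close> becomes \<open>\<nu>\<close>.\<close>

lemma contraction_arithmetic:
  fixes \<eta> \<rho> :: real
  assumes \<rho>: "0 < \<rho>" "\<rho> < \<eta>" "\<rho> = \<mu> * lam * (2 - \<nu> * lam)"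
    and \<nu>: "\<nu> = \<mu> + (m - \<mu>) * (1 + s)\<^sup>2" and s: "s = sqrt (\<eta> / (\<eta> - \<rho>))"
    and C: "C = 1 / (\<eta> - \<rho>) * (1 + sqrt ((\<eta> - \<rho>) / \<eta>))"
    and pos: "\<mu> > 0" "lam > 0"
    and bounds: "\<mu> * X2 \<le> D" "\<mu> * D \<le> A2" "T \<le> m * D" "Sa \<le> (m - \<mu>) * D"
    and var: "T - A2 \<le> Sa"
  shows "X2 - 2 * lam * D + lam\<^sup>2 * ((1 + s) * T - s * A2 + (1 + 1 / s) * Sb)
           + lam\<^sup>2 * C * (\<eta> * Sa + (1 - \<eta>) * Sb)
       \<le> (1 - \<rho>) * (X2 + lam\<^sup>2 * C * Sb)"
proof -
  have "s > 0" using \<rho> by (simp add: s)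
  have s': "sqrt ((\<eta> - \<rho>) / \<eta>) = 1 / s" by (simp add: s real_sqrt_divide)
  have s2: "s * s = \<eta> / (\<eta> - \<rho>)" using \<rho>(1,2) by (simp add: s)
  \<comment> \<open>The two facts about \<open>C\<close> make the coefficients of \<open>Sb\<close> on both sides equal and turn the
    coefficient of \<open>Sa\<close> into the remainder of a square.\<close>
  have Cb: "1 + 1 / s = C * (\<eta> - \<rho>)" unfolding C s' using \<rho>(2) by simp
  have "C * \<eta> = s * s * (1 + 1 / s)" unfolding C s' s2 by simp
  also have "\<dots> = s\<^sup>2 + s" using \<open>s > 0\<close> by (simp add: field_simps power2_eq_square)
  finally have Ca: "C * \<eta> = s\<^sup>2 + s" .
  have "(1 + s) * T - s * A2 + C * \<eta> * Sa = T + s * (T - A2) + (s\<^sup>2 + s) * Sa"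
    by (simp add: Ca algebra_simps)
  also have "\<dots> \<le> T + s * Sa + (s\<^sup>2 + s) * Sa" using var \<open>s > 0\<close> by simp
  also have "\<dots> = T + (s\<^sup>2 + 2 * s) * Sa" by (simp add: algebra_simps)
  also have "\<dots> \<le> m * D + (s\<^sup>2 + 2 * s) * ((m - \<mu>) * D)"
    using bounds \<open>s > 0\<close> by (intro add_mono mult_left_mono) auto
  also have "\<dots> = \<nu> * D" by (simp add: \<nu> power2_eq_square algebra_simps)
  finally have "lam\<^sup>2 * ((1 + s) * T - s * A2 + C * \<eta> * Sa) \<le> lam\<^sup>2 * (\<nu> * D)"
    by (intro mult_left_mono) auto
  then have main: "X2 - 2 * lam * D + lam\<^sup>2 * ((1 + s) * T - s * A2 + C * \<eta> * Sa)
      \<le> X2 - lam * (2 - \<nu> * lam) * D"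
    by (simp add: power2_eq_square algebra_simps)
  have "0 < (\<mu> * lam) * (2 - \<nu> * lam)" "0 < \<mu> * lam" using \<rho> pos by simp_all
  then have "2 - \<nu> * lam > 0" by (rule zero_less_mult_pos)
  then have "lam * (2 - \<nu> * lam) > 0" using pos by simp
  then have "lam * (2 - \<nu> * lam) * (\<mu> * X2) \<le> lam * (2 - \<nu> * lam) * D"
    using bounds(1) by (intro mult_left_mono) auto
  then have "\<rho> * X2 \<le> lam * (2 - \<nu> * lam) * D" by (simp add: \<rho>(3) mult_ac)
  with main have "X2 - 2 * lam * D + lam\<^sup>2 * ((1 + s) * T - s * A2 + C * \<eta> * Sa) \<le> (1 - \<rho>) * X2"
    by (simp add: left_diff_distrib)
  then show ?thesis unfolding Cb by (simp add: algebra_simps)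
qed

section \<open>Random iterations with independent noise\<close>

primrec iterate_with_noise :: "('s \<Rightarrow> 'e \<Rightarrow> 's) \<Rightarrow> 's \<Rightarrow> (nat \<Rightarrow> 'e) \<Rightarrow> nat \<Rightarrow> 's" where
  "iterate_with_noise step s0 e 0 = s0"
| "iterate_with_noise step s0 e (Suc k) = step (iterate_with_noise step s0 e k) (e k)"

lemma iterate_with_noise_cong:
  "(\<And>i. i < k \<Longrightarrow> e i = e' i) \<Longrightarrow> iterate_with_noise step s0 e k = iterate_with_noise step s0 e' k"
  by (induction k) auto

text \<open>Every real function on the finite range is bounded and measurable. The functions \<open>\<phi>\<close> to which this is
applied involve proximal maps and gradients.\<close>

lemma (in finite_measure) integrable_function_of_finite_valued:
  fixes \<phi> :: "'e \<Rightarrow> real"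
  assumes X: "X \<in> measurable M (count_space A)" and "finite A"
  shows "integrable M (\<lambda>\<omega>. \<phi> (X \<omega>))"
proof (rule integrable_const_bound)
  show "AE \<omega> in M. norm (\<phi> (X \<omega>)) \<le> (\<Sum>a\<in>A. norm (\<phi> a))"
  proof (rule AE_I2)
    fix \<omega> assume "\<omega> \<in> space M"
    then have "X \<omega> \<in> A" using measurable_space[OF X] by simp
    then show "norm (\<phi> (X \<omega>)) \<le> (\<Sum>a\<in>A. norm (\<phi> a))"
      using \<open>finite A\<close> by (intro member_le_sum) auto
  qed
  show "(\<lambda>\<omega>. \<phi> (X \<omega>)) \<in> borel_measurable M"
    using X by (rule measurable_compose) simp
qed

lemma (in prob_space) expectation_of_index:
  fixes \<phi> :: "'i \<Rightarrow> real"
  assumes "finite J" and I: "\<And>\<omega>. \<omega> \<in> space M \<Longrightarrow> I \<omega> \<in> J"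
    and ev: "\<And>i. i \<in> J \<Longrightarrow> {\<omega> \<in> space M. I \<omega> = i} \<in> events"
  shows "expectation (\<lambda>\<omega>. \<phi> (I \<omega>)) = (\<Sum>i\<in>J. prob {\<omega> \<in> space M. I \<omega> = i} * \<phi> i)"
proof -
  have "expectation (\<lambda>\<omega>. \<phi> (I \<omega>))
      = expectation (\<lambda>\<omega>. \<Sum>i\<in>J. indicator {\<omega> \<in> space M. I \<omega> = i} \<omega> * \<phi> i)"
  proof (rule Bochner_Integration.integral_cong[OF refl])
    fix \<omega> assume \<omega>: "\<omega> \<in> space M"
    have "(\<Sum>i\<in>J. indicator {\<omega> \<in> space M. I \<omega> = i} \<omega> * \<phi> i) = (\<Sum>i\<in>J. if i = I \<omega> then \<phi> i else 0)"
      using \<omega> by (intro sum.cong) (auto simp: indicator_def)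
    then show "\<phi> (I \<omega>) = (\<Sum>i\<in>J. indicator {\<omega> \<in> space M. I \<omega> = i} \<omega> * \<phi> i)"
      using \<open>finite J\<close> I[OF \<omega>] by simp
  qed
  also have "\<dots> = (\<Sum>i\<in>J. prob {\<omega> \<in> space M. I \<omega> = i} * \<phi> i)"
    using ev by (subst Bochner_Integration.integral_sum) (auto simp: emeasure_eq_measure)
  finally show ?thesis .
qed

text \<open>The state after \<open>k\<close> steps depends only on the first \<open>k\<close> noise values and hence takes finitely many
values. Splitting the expectation according to this value replaces conditioning on the history: the
event that the state equals \<open>s\<close> is independent of the next noise value, so each piece factorizes, and
the hypothesis on a single step applies with \<open>s\<close> fixed.\<close>

lemma (in prob_space) iterate_with_independent_noise_contracts:
  fixes V :: "'s \<Rightarrow> real"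
  assumes A: "finite A" and ind: "indep_vars (\<lambda>_. count_space A) X UNIV"
    and contr: "\<And>s k. expectation (\<lambda>\<omega>. V (step s (X k \<omega>))) \<le> r * V s" and "r \<ge> 0"
  shows "integrable M (\<lambda>\<omega>. V (iterate_with_noise step s0 (\<lambda>i. X i \<omega>) k))"
    and "expectation (\<lambda>\<omega>. V (iterate_with_noise step s0 (\<lambda>i. X i \<omega>) k)) \<le> r ^ k * V s0"
proof -
  let ?S = "\<lambda>k \<omega>. iterate_with_noise step s0 (\<lambda>i. X i \<omega>) k"
  let ?C = "\<lambda>B. PiE B (\<lambda>_. A) :: (nat \<Rightarrow> 'b) set"
  let ?X = "\<lambda>B \<omega>. \<lambda>i\<in>B. X i \<omega>"
  have PiM: "PiM B (\<lambda>_::nat. count_space A) = count_space (?C B)" if "finite B" for B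
    using that A by (intro count_space_PiM_finite) (auto intro: countable_finite)
  have X: "X i \<in> measurable M (count_space A)" for i
    using ind by (auto simp: indep_vars_def)
  have Xm: "?X B \<in> measurable M (count_space (?C B))" if "finite B" for B
    unfolding PiM[OF that, symmetric] by (intro measurable_restrict X)
  have Xin: "X i \<omega> \<in> A" if "\<omega> \<in> space M" for i \<omega>
    using measurable_space[OF X that] by simp
  have S_eq: "?S k \<omega> = iterate_with_noise step s0 (?X {..<k} \<omega>) k" for k \<omega>
    by (rule iterate_with_noise_cong) simp
  have int: "integrable M (\<lambda>\<omega>. \<phi> (?X B \<omega>))" if "finite B" for \<phi> :: "_ \<Rightarrow> real" and B
    using that A by (intro integrable_function_of_finite_valued[OF Xm] finite_PiE) auto
  show "integrable M (\<lambda>\<omega>. V (?S k \<omega>))" for k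
    unfolding S_eq by (rule int[of "{..<k}" "\<lambda>e. V (iterate_with_noise step s0 e k)"]) simp
  show "expectation (\<lambda>\<omega>. V (?S k \<omega>)) \<le> r ^ k * V s0"
  proof (induction k)
    case (Suc k)
    define R where "R = (\<lambda>e. iterate_with_noise step s0 e k) ` ?C {..<k}"
    have "finite R" unfolding R_def using A by (intro finite_imageI finite_PiE) auto
    have SR: "?S k \<omega> \<in> R" if "\<omega> \<in> space M" for \<omega>
      unfolding R_def S_eq using Xin[OF that] by (intro imageI restrict_PiE_iff[THEN iffD2]) simp
    define hit where "hit s \<omega> = (indicator {s} (?S k \<omega>) :: real)" for s \<omega>
    have split: "\<psi> (?S k \<omega>) = (\<Sum>s\<in>R. hit s \<omega> * \<psi> s)" if "\<omega> \<in> space M" for \<psi> :: "'s \<Rightarrow> real" and \<omega>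
    proof -
      have "(\<Sum>s\<in>R. hit s \<omega> * \<psi> s) = (\<Sum>s\<in>R. if s = ?S k \<omega> then \<psi> s else 0)"
        by (intro sum.cong) (auto simp: hit_def indicator_def)
      then show ?thesis using \<open>finite R\<close> SR[OF that] by simp
    qed
    have int_hit: "integrable M (hit s)" for s
      unfolding hit_def S_eq
      by (rule int[of "{..<k}" "\<lambda>e. indicator {s} (iterate_with_noise step s0 e k)"]) simp
    have int_V: "integrable M (\<lambda>\<omega>. V (step s (X k \<omega>)))" for s
      by (rule integrable_function_of_finite_valued[OF X A])
    have indep: "indep_var borel (hit s) borel (\<lambda>\<omega>. V (step s (X k \<omega>)))" for s
    proof -
      have "indep_var borel ((\<lambda>e. indicator {s} (iterate_with_noise step s0 e k) :: real) \<circ> ?X {..<k})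
          borel ((\<lambda>e. V (step s (e k))) \<circ> ?X {k})"
        by (rule indep_var_compose[OF indep_var_restrict[OF ind, of "{..<k}" "{k}"]])
           (simp_all add: PiM)
      then show ?thesis by (simp add: o_def hit_def[abs_def] S_eq)
    qed
    have "expectation (\<lambda>\<omega>. V (?S (Suc k) \<omega>)) = expectation (\<lambda>\<omega>. \<Sum>s\<in>R. hit s \<omega> * V (step s (X k \<omega>)))"
      by (rule Bochner_Integration.integral_cong[OF refl]) (simp, rule split)
    also have "\<dots> = (\<Sum>s\<in>R. expectation (hit s) * expectation (\<lambda>\<omega>. V (step s (X k \<omega>))))"
      using indep_var_lebesgue_integral[OF indep int_hit int_V]
        indep_var_integrable[OF indep int_hit int_V]
      by (subst Bochner_Integration.integral_sum) auto
    also have "\<dots> \<le> (\<Sum>s\<in>R. expectation (hit s) * (r * V s))"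
      by (intro sum_mono mult_left_mono contr integral_nonneg) (auto simp: hit_def)
    also have "\<dots> = r * expectation (\<lambda>\<omega>. \<Sum>s\<in>R. hit s \<omega> * V s)"
      using int_hit by (subst Bochner_Integration.integral_sum) (auto simp: sum_distrib_left mult_ac)
    also have "expectation (\<lambda>\<omega>. \<Sum>s\<in>R. hit s \<omega> * V s) = expectation (\<lambda>\<omega>. V (?S k \<omega>))"
      by (rule Bochner_Integration.integral_cong[OF refl]) (simp add: split)
    also have "r * \<dots> \<le> r * (r ^ k * V s0)"
      using Suc \<open>r \<ge> 0\<close> by (rule mult_left_mono)
    finally show ?case by (simp add: mult_ac)
  qed (simp add: prob_space)
qed

section \<open>A single step around the solution\<close>

lemma mean_fun_GDERIV:
  assumes "\<And>i. i \<in> {1..n} \<Longrightarrow> GDERIV (f i) x :> d i"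
  shows "GDERIV (mean_fun n f) x :> (1 / real n) *\<^sub>R (\<Sum>i=1..n. d i)"
proof -
  have "((\<lambda>x. 1 / real n * (\<Sum>i=1..n. f i x)) has_derivative (\<lambda>h. 1 / real n * (\<Sum>i=1..n. h \<bullet> d i))) (at x)"
    using assms unfolding gderiv_def
    by (intro has_derivative_mult_right has_derivative_sum) auto
  then show ?thesis
    by (simp add: gderiv_def mean_fun_def[abs_def] inner_sum_right)
qed

locale composite_problem =
  fixes n :: nat and f :: "nat \<Rightarrow> 'a::euclidean_space \<Rightarrow> real" and g :: "'a \<Rightarrow> ereal"
    and Li :: "nat \<Rightarrow> real" and \<mu> :: real
  assumes n: "n \<ge> 1" and g: "closed_convex_proper g"
    and smooth: "\<And>i. i \<in> {1..n} \<Longrightarrow> L_smooth (Li i) (f i)"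
    and strong: "strongly_convex \<mu> (mean_fun n f)"
begin

abbreviation "opt \<equiv> solution g (mean_fun n f)"

definition \<Delta> :: "nat \<Rightarrow> 'a \<Rightarrow> 'a" where
  "\<Delta> i x = gradient (f i) x - gradient (f i) opt"

definition \<Delta>mean :: "'a \<Rightarrow> 'a" where
  "\<Delta>mean x = (1 / real n) *\<^sub>R (\<Sum>i=1..n. \<Delta> i x)"

lemma Li_pos: "i \<in> {1..n} \<Longrightarrow> Li i > 0"
  using smooth by (simp add: L_smooth_def)

lemma mu_pos: "\<mu> > 0"
  using strong by (simp add: strongly_convex_def)

lemma GDERIV_mean_fun:
  "GDERIV (mean_fun n f) x :> (1 / real n) *\<^sub>R (\<Sum>i=1..n. gradient (f i) x)"
  using smooth by (intro mean_fun_GDERIV gradient_works) (simp add: L_smooth_def)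

lemma \<Delta>_cocoercive:
  assumes "i \<in> {1..n}"
  shows "(norm (\<Delta> i x))\<^sup>2 \<le> Li i * (\<Delta> i x \<bullet> (x - opt))"
proof -
  have "1 / Li i * (norm (\<Delta> i x))\<^sup>2 \<le> \<Delta> i x \<bullet> (x - opt)"
    using smooth[OF assms] by (simp add: L_smooth_def \<Delta>_def)
  then show ?thesis using Li_pos[OF assms] by (simp add: field_simps)
qed

lemma \<Delta>mean_strong: "\<mu> * (norm (x - opt))\<^sup>2 \<le> \<Delta>mean x \<bullet> (x - opt)"
  using strongly_convex_gradient_monotone[OF strong GDERIV_mean_fun GDERIV_mean_fun, of x opt]
  by (simp add: \<Delta>mean_def \<Delta>_def sum_subtractf scaleR_diff_right)

text \<open>Seen from the solution, a step moves along the direction of a control variate estimator whose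
stored part is evaluated at the snapshot \<open>w\<close>.\<close>

lemma pvrsg_step_distance:
  assumes "lam > 0" "j \<in> {1..n}"
  shows "norm (fst (pvrsg_step n f g lam p j u (x, \<lambda>i. gradient (f i) w)) - opt)
    \<le> norm ((x - opt) - lam *\<^sub>R ((1 / (real n * p j)) *\<^sub>R \<Delta> j x - (1 / (real n * p j)) *\<^sub>R \<Delta> j w + \<Delta>mean w))"
proof -
  have "norm (fst (pvrsg_step n f g lam p j u (x, \<lambda>i. gradient (f i) w)) - opt)
    \<le> norm (x - (lam / real n) *\<^sub>R ((1 / p j) *\<^sub>R (gradient (f j) x - gradient (f j) w)
                 + (\<Sum>i=1..n. gradient (f i) w))
            - (opt - lam *\<^sub>R ((1 / real n) *\<^sub>R (\<Sum>i=1..n. gradient (f i) opt))))"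
    unfolding pvrsg_step_def Let_def prod.case fst_conv
    by (rule prox_step_distance[OF g assms(1) strong GDERIV_mean_fun])
  also have "x - (lam / real n) *\<^sub>R ((1 / p j) *\<^sub>R (gradient (f j) x - gradient (f j) w)
                 + (\<Sum>i=1..n. gradient (f i) w))
            - (opt - lam *\<^sub>R ((1 / real n) *\<^sub>R (\<Sum>i=1..n. gradient (f i) opt)))
      = (x - opt) - lam *\<^sub>R ((1 / (real n * p j)) *\<^sub>R \<Delta> j x - (1 / (real n * p j)) *\<^sub>R \<Delta> j w + \<Delta>mean w)"
    by (simp add: \<Delta>_def \<Delta>mean_def sum_subtractf algebra_simps)
  finally show ?thesis .
qed

text \<open>Under coherent updates all stored vectors are the component gradients at one common point \<open>w\<close>, the
snapshot, so the pair \<open>(x, w)\<close> carries the whole state. A single indicator, here that of component 1,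
decides whether the snapshot moves.\<close>

definition snapshot_step :: "real \<Rightarrow> (nat \<Rightarrow> real) \<Rightarrow> 'a \<times> 'a \<Rightarrow> nat \<times> (nat \<Rightarrow> real) \<Rightarrow> 'a \<times> 'a" where
  "snapshot_step lam p = (\<lambda>(x, w) (j, u).
     (fst (pvrsg_step n f g lam p j u (x, \<lambda>i. gradient (f i) w)), if u 1 = 1 then x else w))"

lemma pvrsg_eq_snapshot_iterates:
  fixes J :: "nat \<Rightarrow> nat" and u :: "nat \<Rightarrow> nat \<Rightarrow> real"
    and lam :: real and p :: "nat \<Rightarrow> real" and x0 xhat :: 'a
  assumes J: "\<And>k. J k \<in> {1..n}" and u: "\<And>k i. i \<in> {1..n} \<Longrightarrow> u k i \<in> {0, 1}"
    and coherent: "\<And>k i. i \<in> {1..n} \<Longrightarrow> u k i = u k 1"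
    and y0: "\<And>i. i \<in> {1..n} \<Longrightarrow> y0 i = gradient (f i) xhat"
  defines "s \<equiv> \<lambda>k. iterate_with_noise (snapshot_step lam p) (x0, xhat) (\<lambda>k. (J k, \<lambda>i\<in>{1..n}. u k i)) k"
  shows "fst (pvrsg n f g lam p x0 y0 J u k) = fst (s k)
    \<and> (\<forall>i\<in>{1..n}. snd (pvrsg n f g lam p x0 y0 J u k) i = gradient (f i) (snd (s k)))"
proof (induction k)
  case 0
  show ?case using y0 by (simp add: s_def)
next
  case (Suc k)
  obtain x y where xy: "pvrsg n f g lam p x0 y0 J u k = (x, y)" by fastforce
  obtain w where sk: "s k = (x, w)" and y: "\<And>i. i \<in> {1..n} \<Longrightarrow> y i = gradient (f i) w"
    using Suc xy by (metis fst_conv snd_conv surj_pair)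
  have "s (Suc k) = (fst (pvrsg_step n f g lam p (J k) (\<lambda>i\<in>{1..n}. u k i) (x, \<lambda>i. gradient (f i) w)),
      if u k 1 = 1 then x else w)"
    using sk n by (simp add: s_def snapshot_step_def)
  moreover have "fst (pvrsg_step n f g lam p (J k) (u k) (x, y))
      = fst (pvrsg_step n f g lam p (J k) (\<lambda>i\<in>{1..n}. u k i) (x, \<lambda>i. gradient (f i) w))"
    using y[OF J[of k]] y by (simp add: pvrsg_step_def Let_def cong: sum.cong_simp)
  moreover have "snd (pvrsg_step n f g lam p (J k) (u k) (x, y)) i
      = gradient (f i) (if u k 1 = 1 then x else w)" if i: "i \<in> {1..n}" for i
    using y[OF i] u[OF i, of k] coherent[OF i, of k] by (auto simp: pvrsg_step_def Let_def)
  ultimately show ?case by (simp add: xy)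
qed

text \<open>The energy is the Lyapunov function of the theorem, expressed through the snapshot instead of the stored
vectors. \<open>dual_weight\<close> is the part of \<open>\<gamma>\<close> that depends on the component; it also bounds the variance
of the estimator.\<close>

definition dual_energy :: "(nat \<Rightarrow> real) \<Rightarrow> 'a \<Rightarrow> real" where
  "dual_energy \<gamma> w = (\<Sum>i=1..n. \<gamma> i * (norm (\<Delta> i w))\<^sup>2)"

definition energy :: "(nat \<Rightarrow> real) \<Rightarrow> 'a \<times> 'a \<Rightarrow> real" where
  "energy \<gamma> = (\<lambda>(x, w). (norm (x - opt))\<^sup>2 + dual_energy \<gamma> w)"

definition dual_weight :: "(nat \<Rightarrow> real) \<Rightarrow> nat \<Rightarrow> real" where
  "dual_weight p i = max 0 (1 - real n * p i * \<mu> / Li i) / ((real n)\<^sup>2 * p i)"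

definition second_moment :: "(nat \<Rightarrow> real) \<Rightarrow> 'a \<Rightarrow> real" where
  "second_moment p x = (\<Sum>i=1..n. (norm (\<Delta> i x))\<^sup>2 / ((real n)\<^sup>2 * p i))"

lemma dual_energy_cmult: "dual_energy (\<lambda>i. c * \<gamma> i) w = c * dual_energy \<gamma> w"
  by (simp add: dual_energy_def sum_distrib_left mult.assoc)

lemma dual_energy_nonneg: "(\<And>i. i \<in> {1..n} \<Longrightarrow> \<gamma> i \<ge> 0) \<Longrightarrow> dual_energy \<gamma> w \<ge> 0"
  unfolding dual_energy_def by (intro sum_nonneg) auto

lemma moment_bounds:
  assumes p: "\<And>i. i \<in> {1..n} \<Longrightarrow> p i > 0"
    and m: "\<And>i. i \<in> {1..n} \<Longrightarrow> Li i / (real n * p i) \<le> m" "\<mu> \<le> m"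
  shows "\<mu> * (\<Delta>mean x \<bullet> (x - opt)) \<le> (norm (\<Delta>mean x))\<^sup>2"
    "second_moment p x \<le> m * (\<Delta>mean x \<bullet> (x - opt))"
    "second_moment p x - (norm (\<Delta>mean x))\<^sup>2 \<le> dual_energy (dual_weight p) x"
    "dual_energy (dual_weight p) x \<le> (m - \<mu>) * (\<Delta>mean x \<bullet> (x - opt))"
  using cocoercive_variance_bounds[where J = "{1..n}" and l = Li and a = "\<lambda>i. \<Delta> i x" and N = "real n",
      OF _ p Li_pos \<Delta>_cocoercive \<Delta>mean_def mu_pos \<Delta>mean_strong m] n
  unfolding second_moment_def dual_energy_def dual_weight_def by simp_all

lemma expected_primal_step:
  assumes p: "(\<Sum>i=1..n. p i) = 1" "\<And>i. i \<in> {1..n} \<Longrightarrow> p i > 0"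
    and m: "\<And>i. i \<in> {1..n} \<Longrightarrow> Li i / (real n * p i) \<le> m" "\<mu> \<le> m"
    and "lam > 0" "s > 0"
  shows "(\<Sum>j=1..n. p j * (norm (fst (pvrsg_step n f g lam p j u (x, \<lambda>i. gradient (f i) w)) - opt))\<^sup>2)
    \<le> (norm (x - opt))\<^sup>2 - 2 * lam * (\<Delta>mean x \<bullet> (x - opt))
      + lam\<^sup>2 * ((1 + s) * second_moment p x - s * (norm (\<Delta>mean x))\<^sup>2
                + (1 + 1 / s) * dual_energy (dual_weight p) w)"
proof -
  define q where "q x i = (1 / (real n * p i)) *\<^sub>R \<Delta> i x" for x i
  have mean: "(\<Sum>i=1..n. p i *\<^sub>R q x i) = \<Delta>mean x" for x
    unfolding \<Delta>mean_def scaleR_sum_right q_def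
    using p(2) by (intro sum.cong) (auto simp: less_imp_neq[symmetric])
  have moment: "(\<Sum>i=1..n. p i * (norm (q x i))\<^sup>2) = second_moment p x" for x
    unfolding second_moment_def q_def
  proof (intro sum.cong refl)
    fix i assume "i \<in> {1..n}"
    then show "p i * (norm ((1 / (real n * p i)) *\<^sub>R \<Delta> i x))\<^sup>2 = (norm (\<Delta> i x))\<^sup>2 / ((real n)\<^sup>2 * p i)"
      using p(2)[of i] n by (simp add: power_mult_distrib power_divide field_simps power2_eq_square)
  qed
  have "(\<Sum>j=1..n. p j * (norm (fst (pvrsg_step n f g lam p j u (x, \<lambda>i. gradient (f i) w)) - opt))\<^sup>2)
      \<le> (\<Sum>j=1..n. p j * (norm ((x - opt) - lam *\<^sub>R (q x j - q w j + \<Delta>mean w)))\<^sup>2)"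
    unfolding q_def using p(2) \<open>lam > 0\<close>
    by (intro sum_mono mult_left_mono power_mono pvrsg_step_distance) (auto simp: less_imp_le)
  also have "\<dots> \<le> (norm (x - opt))\<^sup>2 - 2 * lam * (\<Delta>mean x \<bullet> (x - opt))
      + lam\<^sup>2 * ((1 + s) * second_moment p x - s * (norm (\<Delta>mean x))\<^sup>2
                + (1 + 1 / s) * (second_moment p w - (norm (\<Delta>mean w))\<^sup>2))"
    using control_variate_step[OF p mean mean \<open>s > 0\<close>] unfolding moment .
  also have "\<dots> \<le> (norm (x - opt))\<^sup>2 - 2 * lam * (\<Delta>mean x \<bullet> (x - opt))
      + lam\<^sup>2 * ((1 + s) * second_moment p x - s * (norm (\<Delta>mean x))\<^sup>2
                + (1 + 1 / s) * dual_energy (dual_weight p) w)"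
    using moment_bounds(3)[OF p(2) m, of w] \<open>s > 0\<close>
    by (intro add_left_mono mult_left_mono) auto
  finally show ?thesis .
qed

end

section \<open>Expected decrease and convergence of the iterates\<close>

locale pvrsg_run = composite_problem n f g Li \<mu> + prob_space M
  for n :: nat and f :: "nat \<Rightarrow> 'a::euclidean_space \<Rightarrow> real" and g Li \<mu> and M :: "'w measure" +
  fixes lam \<eta> :: real and p :: "nat \<Rightarrow> real" and I :: "nat \<Rightarrow> 'w \<Rightarrow> nat"
    and U :: "nat \<Rightarrow> nat \<Rightarrow> 'w \<Rightarrow> real" and y0 :: "nat \<Rightarrow> 'a"
  assumes lam: "lam > 0"
    and sampling: "pvrsg_sampling M n p (\<lambda>_. \<eta>) I U"
    and coherent: "coherent_dual_update M n f y0 U"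
begin

lemma sample_measurable: "pvrsg_sample n I U k \<in> measurable M (count_space (sample_space n))"
  using sampling by (auto simp: pvrsg_sampling_def indep_vars_def)

lemma finite_sample_space: "finite (sample_space n)"
  unfolding sample_space_def by (intro finite_cartesian_product finite_PiE) auto

lemma sample_values:
  assumes "\<omega> \<in> space M"
  shows "I k \<omega> \<in> {1..n}" and "i \<in> {1..n} \<Longrightarrow> U k i \<omega> \<in> {0, 1}"
proof -
  have mem: "pvrsg_sample n I U k \<omega> \<in> sample_space n"
    using measurable_space[OF sample_measurable assms] by simp
  then show "I k \<omega> \<in> {1..n}" by (simp add: pvrsg_sample_def sample_space_def)
  assume i: "i \<in> {1..n}"
  have "(\<lambda>i\<in>{1..n}. U k i \<omega>) i \<in> {0, 1}"
    using mem i unfolding pvrsg_sample_def sample_space_def by (metis PiE_mem mem_Sigma_iff)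
  with i show "U k i \<omega> \<in> {0, 1}" by simp
qed

lemma p_pos: "i \<in> {1..n} \<Longrightarrow> p i > 0"
  using sampling by (simp add: pvrsg_sampling_def)

lemma prob_I: "i \<in> {1..n} \<Longrightarrow> prob {\<omega> \<in> space M. I k \<omega> = i} = p i"
  using sampling by (simp add: pvrsg_sampling_def)

lemma expectation_U: "i \<in> {1..n} \<Longrightarrow> expectation (U k i) = \<eta>"
  using sampling by (simp add: pvrsg_sampling_def)

lemma I_event: "{\<omega> \<in> space M. I k \<omega> = i} \<in> events"
proof -
  have "{\<omega> \<in> space M. I k \<omega> = i} = pvrsg_sample n I U k -` {a \<in> sample_space n. fst a = i} \<inter> space M"
    using measurable_space[OF sample_measurable] by (auto simp: pvrsg_sample_def)
  also have "\<dots> \<in> events" by (rule measurable_sets[OF sample_measurable]) auto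
  finally show ?thesis .
qed

lemma expectation_I: "expectation (\<lambda>\<omega>. \<phi> (I k \<omega>)) = (\<Sum>i=1..n. p i * \<phi> i)" for \<phi> :: "nat \<Rightarrow> real"
  using expectation_of_index[of "{1..n}" "I k" \<phi>] sample_values(1) I_event prob_I by simp

lemma p_sum: "(\<Sum>i=1..n. p i) = 1"
  using expectation_I[of "\<lambda>_. 1" 0] by (simp add: prob_space)

lemma integrable_sample: "integrable M (\<lambda>\<omega>. \<phi> (pvrsg_sample n I U k \<omega>))" for \<phi> :: "_ \<Rightarrow> real"
  by (rule integrable_function_of_finite_valued[OF sample_measurable finite_sample_space])

lemma integrable_U: "i \<in> {1..n} \<Longrightarrow> integrable M (U k i)"
  using integrable_sample[of "\<lambda>a. snd a i" k] by (simp add: pvrsg_sample_def)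

lemma \<eta>_le_1: "\<eta> \<le> 1"
proof -
  have "expectation (U 0 1) \<le> expectation (\<lambda>_. 1)"
    using n integrable_U sample_values(2)[of _ 1 0] by (intro integral_mono) (auto, fastforce)
  then show ?thesis using expectation_U[of 1] n by (simp add: prob_space)
qed

text \<open>The primal part depends on the noise only through the index and the dual part only through the
indicator, so linearity of the expectation separates the two, whatever their joint law. The new primal
point is a function of the index alone; the indicators in \<^const>\<open>pvrsg_step\<close> are filled in with \<open>0\<close>.\<close>

lemma expected_energy_step:
  "expectation (\<lambda>\<omega>. energy \<gamma> (snapshot_step lam p (x, w) (pvrsg_sample n I U k \<omega>)))
   = (\<Sum>j=1..n. p j * (norm (fst (pvrsg_step n f g lam p j (\<lambda>_. 0) (x, \<lambda>i. gradient (f i) w)) - opt))\<^sup>2)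
     + (\<eta> * dual_energy \<gamma> x + (1 - \<eta>) * dual_energy \<gamma> w)"
proof -
  let ?P = "\<lambda>j. (norm (fst (pvrsg_step n f g lam p j (\<lambda>_. 0) (x, \<lambda>i. gradient (f i) w)) - opt))\<^sup>2"
  have "expectation (\<lambda>\<omega>. energy \<gamma> (snapshot_step lam p (x, w) (pvrsg_sample n I U k \<omega>)))
      = expectation (\<lambda>\<omega>. ?P (I k \<omega>) + (U k 1 \<omega> * (dual_energy \<gamma> x - dual_energy \<gamma> w) + dual_energy \<gamma> w))"
  proof (rule Bochner_Integration.integral_cong[OF refl])
    fix \<omega> assume "\<omega> \<in> space M"
    then have "U k 1 \<omega> \<in> {0, 1}" using sample_values(2)[of \<omega> 1 k] n by simp
    then show "energy \<gamma> (snapshot_step lam p (x, w) (pvrsg_sample n I U k \<omega>))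
        = ?P (I k \<omega>) + (U k 1 \<omega> * (dual_energy \<gamma> x - dual_energy \<gamma> w) + dual_energy \<gamma> w)"
      using n by (auto simp: energy_def snapshot_step_def pvrsg_sample_def pvrsg_step_def Let_def)
  qed
  also have "\<dots> = expectation (\<lambda>\<omega>. ?P (I k \<omega>))
      + (expectation (U k 1) * (dual_energy \<gamma> x - dual_energy \<gamma> w) + dual_energy \<gamma> w)"
    using integrable_sample[of "\<lambda>a. ?P (fst a)" k] integrable_U[of 1 k] n
    by (subst Bochner_Integration.integral_add) (auto simp: pvrsg_sample_def prob_space)
  finally show ?thesis
    using expectation_U[of 1 k] n unfolding expectation_I[of ?P k] by (simp add: algebra_simps)
qed

text \<open>A contraction of the energy at every fixed state gives the rate for the iterates. The algorithm
agrees with the snapshot process where all indicators of an iteration coincide, that is, almost surely;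
the expectation is transferred along this event.\<close>

lemma pvrsg_linear_rate:
  fixes x0 :: 'a
  assumes contr: "\<And>x w. (\<Sum>j=1..n. p j * (norm (fst (pvrsg_step n f g lam p j (\<lambda>_. 0) (x, \<lambda>i. gradient (f i) w)) - opt))\<^sup>2)
     + (\<eta> * dual_energy \<gamma> x + (1 - \<eta>) * dual_energy \<gamma> w) \<le> r * ((norm (x - opt))\<^sup>2 + dual_energy \<gamma> w)"
    and "r \<ge> 0" and \<gamma>: "\<And>i. i \<in> {1..n} \<Longrightarrow> \<gamma> i \<ge> 0"
  shows "(\<lambda>k. \<integral>\<omega>. (norm (fst (pvrsg n f g lam p x0 y0 (\<lambda>k. I k \<omega>) (\<lambda>k i. U k i \<omega>) k) - opt))\<^sup>2
           + (\<Sum>i=1..n. \<gamma> i * (norm (snd (pvrsg n f g lam p x0 y0 (\<lambda>k. I k \<omega>) (\<lambda>k i. U k i \<omega>) k) i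
                - gradient (f i) opt))\<^sup>2) \<partial>M) \<in> O(\<lambda>k. r ^ k)"
    (is "(\<lambda>k. \<integral>\<omega>. ?E k \<omega> \<partial>M) \<in> _")
proof -
  obtain xhat where xhat: "\<And>i. i \<in> {1..n} \<Longrightarrow> y0 i = gradient (f i) xhat"
    using coherent by (auto simp: coherent_dual_update_def)
  let ?S = "\<lambda>k \<omega>. iterate_with_noise (snapshot_step lam p) (x0, xhat) (\<lambda>k. pvrsg_sample n I U k \<omega>) k"
  have ind: "indep_vars (\<lambda>_. count_space (sample_space n)) (pvrsg_sample n I U) UNIV"
    using sampling by (simp add: pvrsg_sampling_def)
  have step: "expectation (\<lambda>\<omega>. energy \<gamma> (snapshot_step lam p s (pvrsg_sample n I U k \<omega>))) \<le> r * energy \<gamma> s" for s k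
    using contr by (cases s) (simp add: expected_energy_step, simp add: energy_def)
  note iter = iterate_with_independent_noise_contracts
    [where V = "energy \<gamma>" and step = "snapshot_step lam p" and X = "pvrsg_sample n I U", OF finite_sample_space ind step \<open>r \<ge> 0\<close>]
  have "AE \<omega> in M. \<forall>k. \<forall>i\<in>{1..n}. \<forall>j\<in>{1..n}. U k i \<omega> = U k j \<omega>"
    unfolding AE_all_countable using coherent unfolding coherent_dual_update_def by (rule conjunct2)
  then have AE: "AE \<omega> in M. \<forall>k. ?E k \<omega> = energy \<gamma> (?S k \<omega>)"
  proof (rule AE_mp, intro AE_I2 impI allI)
    have one: "1 \<in> {1..n}" using n by simp
    fix \<omega> k assume \<omega>: "\<omega> \<in> space M" and "\<forall>k. \<forall>i\<in>{1..n}. \<forall>j\<in>{1..n}. U k i \<omega> = U k j \<omega>"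
    then have "U k i \<omega> = U k 1 \<omega>" if "i \<in> {1..n}" for k i
      using that one by blast
    from pvrsg_eq_snapshot_iterates[where J = "\<lambda>k. I k \<omega>" and u = "\<lambda>k i. U k i \<omega>", OF sample_values(1)[OF \<omega>] sample_values(2)[OF \<omega>] this xhat, of lam p x0 k]
    show "?E k \<omega> = energy \<gamma> (?S k \<omega>)"
      by (simp add: energy_def dual_energy_def \<Delta>_def split_beta pvrsg_sample_def)
  qed
  have nonneg: "?E k \<omega> \<ge> 0" for k \<omega>
    using \<gamma> by (intro add_nonneg_nonneg sum_nonneg mult_nonneg_nonneg) auto
  have e0: "energy \<gamma> s \<ge> 0" for s
    using dual_energy_nonneg[OF \<gamma>] by (simp add: energy_def split_beta)
  have bound: "(\<integral>\<omega>. ?E k \<omega> \<partial>M) \<le> energy \<gamma> (x0, xhat) * r ^ k" for k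
  \<comment> \<open>Without integrability the integral is \<open>0\<close> by convention, and the bound is trivial; with it,
    measurability is available and the almost sure identity transfers the expectation.\<close>
  proof (cases "integrable M (?E k)")
    case True
    then have "(\<integral>\<omega>. ?E k \<omega> \<partial>M) = expectation (\<lambda>\<omega>. energy \<gamma> (?S k \<omega>))"
      using AE iter(1) by (intro integral_cong_AE) (auto dest: borel_measurable_integrable)
    also have "\<dots> \<le> r ^ k * energy \<gamma> (x0, xhat)" by (rule iter(2))
    finally show ?thesis by (simp add: mult.commute)
  next
    case False
    then show ?thesis using e0 \<open>r \<ge> 0\<close> by (simp add: not_integrable_integral_eq)
  qed
  show ?thesis
  proof (rule bigoI[of _ "energy \<gamma> (x0, xhat)"], rule always_eventually, rule allI)
    fix k
    have "(\<integral>\<omega>. ?E k \<omega> \<partial>M) \<ge> 0" using nonneg by (rule Bochner_Integration.integral_nonneg)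
    then show "norm (\<integral>\<omega>. ?E k \<omega> \<partial>M) \<le> energy \<gamma> (x0, xhat) * norm (r ^ k)"
      using bound[of k] \<open>r \<ge> 0\<close> by simp
  qed
qed

end

theorem theorem4p2:
  fixes n :: nat
    and g :: "real ^ 'N \<Rightarrow> ereal"
    and f :: "nat \<Rightarrow> real ^ 'N \<Rightarrow> real"
    and Li :: "nat \<Rightarrow> real"
    and L \<mu> lam \<eta> :: real
    and p :: "nat \<Rightarrow> real"
    and M :: "'w measure"
    and I :: "nat \<Rightarrow> 'w \<Rightarrow> nat"
    and U :: "nat \<Rightarrow> nat \<Rightarrow> 'w \<Rightarrow> real"
    and x0 :: "real ^ 'N"
    and y0 :: "nat \<Rightarrow> real ^ 'N"
    and x :: "nat \<Rightarrow> 'w \<Rightarrow> real ^ 'N"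
    and y :: "nat \<Rightarrow> nat \<Rightarrow> 'w \<Rightarrow> real ^ 'N"
    and xstar :: "real ^ 'N"
    and ystar :: "nat \<Rightarrow> real ^ 'N"
    and m :: real
  assumes n: "n \<ge> 1"
    and g: "closed_convex_proper g"
    and f: "\<And>i. i \<in> {1..n} \<Longrightarrow> convex_on UNIV (f i) \<and> L_smooth (Li i) (f i)"
    and F: "strongly_convex \<mu> (mean_fun n f)" "L_smooth L (mean_fun n f)"
    and L: "L \<le> 1 / real n * (\<Sum>i=1..n. Li i)"
    and stepsize: "lam > 0"
    and sampling: "pvrsg_sampling M n p (\<lambda>_. \<eta>) I U"
    and coherent: "coherent_dual_update M n f y0 U"
  defines "x \<equiv> (\<lambda>k \<omega>. fst (pvrsg n f g lam p x0 y0 (\<lambda>k. I k \<omega>) (\<lambda>k i. U k i \<omega>) k))"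
    and "y \<equiv> (\<lambda>k i \<omega>. snd (pvrsg n f g lam p x0 y0 (\<lambda>k. I k \<omega>) (\<lambda>k i. U k i \<omega>) k) i)"
    and "xstar \<equiv> solution g (mean_fun n f)"
    and "ystar \<equiv> (\<lambda>i. gradient (f i) xstar)"
    and "m \<equiv> (MAX i\<in>{1..n}. Li i / (real n * p i))"
  shows "(m > \<mu> \<longrightarrow>
           (\<forall>\<rho> \<nu> \<gamma>.
              0 < \<rho> \<and> \<rho> < \<eta> \<and>
              \<nu> = \<mu> + (m - \<mu>) * (1 + sqrt (\<eta> / (\<eta> - \<rho>)))\<^sup>2 \<and>
              \<rho> = \<mu> * lam * (2 - \<nu> * lam) \<and>
              (\<forall>i\<in>{1..n}. \<gamma> i = lam\<^sup>2 / ((real n)\<^sup>2 * p i) * (1 / (\<eta> - \<rho>))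
                   * max 0 (1 - real n * p i * \<mu> / Li i) * (1 + sqrt ((\<eta> - \<rho>) / \<eta>))) \<longrightarrow>
              (\<lambda>k. \<integral>\<omega>. (norm (x k \<omega> - xstar))\<^sup>2
                       + (\<Sum>i=1..n. \<gamma> i * (norm (y k i \<omega> - ystar i))\<^sup>2) \<partial>M)
                \<in> O(\<lambda>k. (1 - \<rho>) ^ k))) \<and>
         (m = \<mu> \<longrightarrow>
           (\<forall>\<rho>. 0 < \<rho> \<and> \<rho> \<le> 1 \<and> \<rho> = \<mu> * lam * (2 - \<mu> * lam) \<longrightarrow>
              (\<lambda>k. \<integral>\<omega>. (norm (x k \<omega> - xstar))\<^sup>2 \<partial>M) \<in> O(\<lambda>k. (1 - \<rho>) ^ k)))"
proof -
  have "prob_space M" using sampling by (simp add: pvrsg_sampling_def)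
  moreover have "composite_problem n f g Li \<mu>"
    by (rule composite_problem.intro) (use n g f F(1) in \<open>simp_all del: One_nat_def\<close>)
  moreover have "pvrsg_run_axioms n f M lam \<eta> p I U y0"
    by (rule pvrsg_run_axioms.intro[OF stepsize sampling coherent])
  ultimately interpret pvrsg_run n f g Li \<mu> M lam \<eta> p I U y0
    by (intro pvrsg_run.intro)
  have m_ge: "Li i / (real n * p i) \<le> m" if "i \<in> {1..n}" for i
    unfolding m_def using that by (intro Max_ge) auto
  show ?thesis
  proof (intro conjI impI allI)
    fix \<rho> \<nu> :: real and \<gamma> :: "nat \<Rightarrow> real"
    assume "\<mu> < m" and asm: "0 < \<rho> \<and> \<rho> < \<eta> \<and>
        \<nu> = \<mu> + (m - \<mu>) * (1 + sqrt (\<eta> / (\<eta> - \<rho>)))\<^sup>2 \<and> \<rho> = \<mu> * lam * (2 - \<nu> * lam) \<and>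
        (\<forall>i\<in>{1..n}. \<gamma> i = lam\<^sup>2 / ((real n)\<^sup>2 * p i) * (1 / (\<eta> - \<rho>))
           * max 0 (1 - real n * p i * \<mu> / Li i) * (1 + sqrt ((\<eta> - \<rho>) / \<eta>)))"
    define s where "s = sqrt (\<eta> / (\<eta> - \<rho>))"
    define C where "C = 1 / (\<eta> - \<rho>) * (1 + sqrt ((\<eta> - \<rho>) / \<eta>))"
    have \<rho>: "0 < \<rho>" "\<rho> < \<eta>" and \<rho>_eq: "\<rho> = \<mu> * lam * (2 - \<nu> * lam)"
      and \<nu>_eq: "\<nu> = \<mu> + (m - \<mu>) * (1 + s)\<^sup>2"
      using asm unfolding s_def by blast+
    have "s > 0" "C \<ge> 0" using \<rho> by (simp_all add: s_def C_def)
    have \<gamma>: "\<gamma> i = lam\<^sup>2 * C * dual_weight p i" if "i \<in> {1..n}" for i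
      using asm[THEN conjunct2, THEN conjunct2, THEN conjunct2, THEN conjunct2] that
      by (simp add: C_def dual_weight_def mult_ac)
    have dual: "dual_energy \<gamma> w = lam\<^sup>2 * C * dual_energy (dual_weight p) w" for w
      unfolding dual_energy_cmult[symmetric] using \<gamma> by (simp add: dual_energy_def)
    have "\<mu> \<le> m" using \<open>\<mu> < m\<close> by simp
    note bounds = moment_bounds[OF p_pos m_ge \<open>\<mu> \<le> m\<close>]
    show "(\<lambda>k. \<integral>\<omega>. (norm (x k \<omega> - xstar))\<^sup>2
        + (\<Sum>i=1..n. \<gamma> i * (norm (y k i \<omega> - ystar i))\<^sup>2) \<partial>M) \<in> O(\<lambda>k. (1 - \<rho>) ^ k)"
      unfolding x_def y_def xstar_def ystar_def
    proof (rule pvrsg_linear_rate)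
      fix x w
      let ?Sx = "dual_energy (dual_weight p) x" and ?Sw = "dual_energy (dual_weight p) w"
      have "(\<Sum>j=1..n. p j * (norm (fst (pvrsg_step n f g lam p j (\<lambda>_. 0) (x, \<lambda>i. gradient (f i) w)) - opt))\<^sup>2)
          + (\<eta> * dual_energy \<gamma> x + (1 - \<eta>) * dual_energy \<gamma> w)
          \<le> (norm (x - opt))\<^sup>2 - 2 * lam * (\<Delta>mean x \<bullet> (x - opt))
            + lam\<^sup>2 * ((1 + s) * second_moment p x - s * (norm (\<Delta>mean x))\<^sup>2 + (1 + 1 / s) * ?Sw)
            + lam\<^sup>2 * C * (\<eta> * ?Sx + (1 - \<eta>) * ?Sw)"
        using expected_primal_step[OF p_sum p_pos m_ge \<open>\<mu> \<le> m\<close> stepsize \<open>s > 0\<close>, of "\<lambda>_. 0" x w]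
        by (simp add: dual algebra_simps)
      also have "\<dots> \<le> (1 - \<rho>) * ((norm (x - opt))\<^sup>2 + lam\<^sup>2 * C * ?Sw)"
        by (rule contraction_arithmetic[OF \<rho> \<rho>_eq \<nu>_eq s_def C_def mu_pos stepsize \<Delta>mean_strong
              bounds(1,2,4,3)])
      finally show "(\<Sum>j=1..n. p j * (norm (fst (pvrsg_step n f g lam p j (\<lambda>_. 0) (x, \<lambda>i. gradient (f i) w)) - opt))\<^sup>2)
          + (\<eta> * dual_energy \<gamma> x + (1 - \<eta>) * dual_energy \<gamma> w)
          \<le> (1 - \<rho>) * ((norm (x - opt))\<^sup>2 + dual_energy \<gamma> w)"
        by (simp add: dual)
    next
      show "0 \<le> 1 - \<rho>" using \<rho> \<eta>_le_1 by simp
      show "0 \<le> \<gamma> i" if "i \<in> {1..n}" for i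
        unfolding \<gamma>[OF that] dual_weight_def using \<open>C \<ge> 0\<close> p_pos[OF that] by simp
    qed
  next
    fix \<rho> :: real
    assume "m = \<mu>" and asm: "0 < \<rho> \<and> \<rho> \<le> 1 \<and> \<rho> = \<mu> * lam * (2 - \<mu> * lam)"
    have \<rho>_eq: "\<rho> = \<mu> * lam * (2 - \<mu> * lam)" using asm by blast
    have "\<mu> \<le> m" using \<open>m = \<mu>\<close> by simp
    note bounds = moment_bounds[OF p_pos m_ge \<open>\<mu> \<le> m\<close>]
    \<comment> \<open>All weights vanish in this case, so the estimator has no variance and the method
      behaves in mean square like the proximal gradient method.\<close>
    have zero: "dual_energy (dual_weight p) w = 0" for w
    proof (rule antisym)
      show "dual_energy (dual_weight p) w \<le> 0" using bounds(4)[of w] \<open>m = \<mu>\<close> by simp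
      show "0 \<le> dual_energy (dual_weight p) w"
        using p_pos by (intro dual_energy_nonneg) (simp add: dual_weight_def less_imp_le)
    qed
    have "(\<lambda>k. \<integral>\<omega>. (norm (x k \<omega> - xstar))\<^sup>2
        + (\<Sum>i=1..n. 0 * (norm (y k i \<omega> - ystar i))\<^sup>2) \<partial>M) \<in> O(\<lambda>k. (1 - \<rho>) ^ k)"
      unfolding x_def y_def xstar_def ystar_def
    proof (rule pvrsg_linear_rate)
      fix x w
      let ?D = "\<Delta>mean x \<bullet> (x - opt)"
      have "(\<Sum>j=1..n. p j * (norm (fst (pvrsg_step n f g lam p j (\<lambda>_. 0) (x, \<lambda>i. gradient (f i) w)) - opt))\<^sup>2)
          \<le> (norm (x - opt))\<^sup>2 - 2 * lam * ?D
            + lam\<^sup>2 * (2 * second_moment p x - (norm (\<Delta>mean x))\<^sup>2)"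
        using expected_primal_step[OF p_sum p_pos m_ge \<open>\<mu> \<le> m\<close> stepsize zero_less_one, of "\<lambda>_. 0" x w]
        by (simp add: zero)
      also have "\<dots> \<le> (norm (x - opt))\<^sup>2 - 2 * lam * ?D + lam\<^sup>2 * (\<mu> * ?D)"
        using bounds(2,3)[of x] \<open>m = \<mu>\<close> zero by (intro add_left_mono mult_left_mono) auto
      also have "\<dots> = (norm (x - opt))\<^sup>2 - lam * (2 - \<mu> * lam) * ?D"
        by (simp add: power2_eq_square algebra_simps)
      also have "\<dots> \<le> (norm (x - opt))\<^sup>2 - lam * (2 - \<mu> * lam) * (\<mu> * (norm (x - opt))\<^sup>2)"
      proof -
        have "0 < (\<mu> * lam) * (2 - \<mu> * lam)" "0 < \<mu> * lam"
          using asm mu_pos stepsize by simp_all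
        then have "2 - \<mu> * lam > 0" by (rule zero_less_mult_pos)
        then have "lam * (2 - \<mu> * lam) > 0" using stepsize by simp
        then show ?thesis using \<Delta>mean_strong[of x] by (intro diff_left_mono mult_left_mono) auto
      qed
      also have "\<dots> = (1 - \<rho>) * (norm (x - opt))\<^sup>2" unfolding \<rho>_eq by (simp add: algebra_simps)
      finally show "(\<Sum>j=1..n. p j * (norm (fst (pvrsg_step n f g lam p j (\<lambda>_. 0) (x, \<lambda>i. gradient (f i) w)) - opt))\<^sup>2)
          + (\<eta> * dual_energy (\<lambda>_. 0) x + (1 - \<eta>) * dual_energy (\<lambda>_. 0) w)
          \<le> (1 - \<rho>) * ((norm (x - opt))\<^sup>2 + dual_energy (\<lambda>_. 0) w)"
        by (simp add: dual_energy_def)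
    qed (use asm in auto)
    then show "(\<lambda>k. \<integral>\<omega>. (norm (x k \<omega> - xstar))\<^sup>2 \<partial>M) \<in> O(\<lambda>k. (1 - \<rho>) ^ k)"
      by simp
  qed
qed

end
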